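(* Let $P(z)=\sum_{j=0}^n p_j z^j$ ($p_n\neq 0$) be a polynomial of degree $n\ge 1$ with either real or purely imaginary coefficients such that $E=P^{-1}([-1,1])=E_1\cup E_2$ has exactly two connected components $E_1,E_2$, with $E_1^*=E_1$ and $E_2^*=E_2$. Let $n_1,n_2$ be the number of zeros of $P$ in $E_1$, $E_2$, respectively, and let $z_1$ be the critical point of $P$ in $\mathbb{C}\setminus E$. Then the centers $a_1,a_2$ of the lemniscatic domain corresponding to $E$ are real with $a_1<a_2$ and are given by $$a_1=-\frac{p_{n-1}}{n p_n}-\left(\left(\frac{n_2}{n_1}\right)^{n_1}\frac{(-1)^{n_2}}{2p_n}\Big(P(z_1)+\sqrt{P(z_1)^2-1}\Big)\right)^{1/n},$$ $$a_2=-\frac{p_{n-1}}{n p_n}+\left(\left(\frac{n_1}{n_2}\right)^{n_2}\frac{(-1)^{n_2}}{2p_n}\Big(P(z_1)+\sqrt{P(z_1)^2-1}\Big)\right)^{1/n},$$ with the positive real $n$-th root in both formulas.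
   Context: Notation: $\widehat{\mathbb{C}}=\mathbb{C}\cup\{\infty\}$; $K^{c}=\widehat{\mathbb{C}}\setminus K$; $K^*=\{\overline z: z\in K\}$; $\operatorname{cap}$ is logarithmic capacity. Walsh's theorem (known; defines the centers): Let $E_1,\dots,E_\ell\subseteq\mathbb{C}$ be disjoint, simply connected (i.e. connected with connected complement in $\widehat{\mathbb C}$), infinite compact sets and $E=\bigcup_{j=1}^\ell E_j$, so that $E^c$ is an $\ell$-connected domain. Then there exist a unique compact set of the form $L=\{w\in\mathbb{C}: |U(w)|\le \operatorname{cap}(E)\}$, $U(w)=\prod_{j=1}^\ell (w-a_j)^{m_j}$, with distinct $a_1,\dots,a_\ell\in\mathbb{C}$ (the centers) and real $m_1,\dots,m_\ell>0$ (the exponents), $\sum_j m_j=1$, and a unique conformal map $\Phi:E^c\to L^c$ with $\Phi(z)=z+O(1/z)$ at $\infty$. The set $L$ has $\ell$ disjoint compact components $L_1,\dots,L_\ell$ with $a_j\in L_j$, labeled such that $\Phi$ maps a Jordan curve surrounding $E_j$ onto a Jordan curve surrounding $L_j$. For a polynomial $P$ of degree $n\ge1$, the set $E=P^{-1}([-1,1])$ has finitely many components, each an infinite compact set, and $E^c$ is connected, so Walsh's theorem applies. Conventions: Zeros are counted with multiplicity. When all components satisfy $E_j^*=E_j$, each $E_j\cap\mathbb{R}$ is a point or an interval, and the components are labeled from left to right: $x\in E_j\cap\mathbb{R}$, $y\in E_{j+1}\cap\mathbb{R}$ implies $x<y$. The function $\sqrt{P(z)^2-1}$ on $\mathbb{C}\setminus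 E$ denotes the analytic branch (with branch cut along $E$) which behaves as $P(z)$ at $\infty$; equivalently, the square root for which $|P(z)+\sqrt{P(z)^2-1}|>1$ on $\mathbb{C}\setminus E$. When $E$ has two components, $P$ has exactly one critical point (counted with multiplicity) in $\mathbb{C}\setminus E$. *)

theory Defs
  imports
    "HOL-Complex_Analysis.Complex_Analysis"
    "HOL-Probability.Probability_Measure"
    "HOL-Library.Landau_Symbols"
    "HOL-Computational_Algebra.Computational_Algebra"
begin

text \<open>
  Logarithmic energy of a finite Borel measure \<open>\<mu>\<close> with compact support, i.e. the double integral
  of \<open>log (1 / \<bar>z - w\<bar>)\<close>, with value \<open>\<infinity>\<close> on the diagonal (the case distinction is needed because
  \<open>ln 0 = 0\<close> in HOL). The positive and the negative part of the kernel are integrated separately,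
  using that \<^const>\<open>ennreal\<close> maps negative reals to \<open>0\<close>. The second integral is finite for compactly
  supported \<open>\<mu>\<close>.
\<close>

definition log_energy :: "complex measure \<Rightarrow> ereal" where
  "log_energy \<mu> =
     enn2ereal (\<integral>\<^sup>+z. (\<integral>\<^sup>+w. (if z = w then \<infinity> else ennreal (- ln (cmod (z - w)))) \<partial>\<mu>) \<partial>\<mu>)
     - enn2ereal (\<integral>\<^sup>+z. (\<integral>\<^sup>+w. ennreal (ln (cmod (z - w))) \<partial>\<mu>) \<partial>\<mu>)"

definition prob_measures_on :: "complex set \<Rightarrow> complex measure set" where
  "prob_measures_on K =
     {\<mu>. sets \<mu> = sets borel \<and> prob_space \<mu> \<and> emeasure \<mu> (- K) = 0}"

text \<open>
  Logarithmic capacity \<open>exp (- V)\<close> of a compact set, \<open>V\<close> being the minimal energy (Robin's constant);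
  it is \<open>0\<close> for polar sets.
\<close>

definition log_capacity :: "complex set \<Rightarrow> real" where
  "log_capacity K =
     (let V = (INF \<mu>\<in>prob_measures_on K. log_energy \<mu>)
      in if V = \<infinity> then 0 else exp (- real_of_ereal V))"

text \<open>
  The set \<open>{w. \<bar>U w\<bar> \<le> c}\<close> for \<open>U w = (\<Prod>j. (w - a j) ^ m j)\<close>. For real exponents \<open>U\<close> is multivalued,
  but its modulus is not.
\<close>

definition lemniscatic_set ::
    "nat \<Rightarrow> (nat \<Rightarrow> complex) \<Rightarrow> (nat \<Rightarrow> real) \<Rightarrow> real \<Rightarrow> complex set" where
  "lemniscatic_set l a m c = {w. (\<Prod>j\<in>{1..l}. cmod (w - a j) powr m j) \<le> c}"

text \<open>
  \<open>\<gamma>\<close> is a Jordan curve that separates the part \<open>A\<close> of \<open>S\<close>, in its interior, from the rest of \<open>S\<close>,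
  in its exterior.
\<close>

definition surrounds :: "(real \<Rightarrow> complex) \<Rightarrow> complex set \<Rightarrow> complex set \<Rightarrow> bool" where
  "surrounds \<gamma> A S \<longleftrightarrow>
     simple_path \<gamma> \<and> pathfinish \<gamma> = pathstart \<gamma> \<and>
     A \<subseteq> inside (path_image \<gamma>) \<and> S - A \<subseteq> outside (path_image \<gamma>)"

text \<open>
  The objects of Walsh's theorem for the disjoint, simply connected, infinite compact sets
  \<open>E 1, \<dots>, E l\<close>: centers \<open>a j\<close>, exponents \<open>m j\<close>, and the conformal map \<open>\<Phi>\<close> from the complement of
  \<open>\<Union>j. E j\<close> onto the lemniscatic domain. Both domains contain \<open>\<infinity>\<close> on the Riemann sphere; since
  \<open>\<Phi> z = z + O(1/z)\<close> fixes \<open>\<infinity>\<close>, the map is given by its restriction to the finite points.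
  The index \<open>j\<close> of \<open>a j\<close> is tied to that of \<open>E j\<close> by the last conjunct.
\<close>

definition walsh_map ::
    "nat \<Rightarrow> (nat \<Rightarrow> complex set) \<Rightarrow> (nat \<Rightarrow> complex) \<Rightarrow> (nat \<Rightarrow> real) \<Rightarrow> (complex \<Rightarrow> complex) \<Rightarrow> bool" where
  "walsh_map l E a m \<Phi> \<longleftrightarrow>
     (let K = (\<Union>j\<in>{1..l}. E j);
          L = lemniscatic_set l a m (log_capacity K);
          L_comp = (\<lambda>j. connected_component_set L (a j))
      in inj_on a {1..l} \<and> (\<forall>j\<in>{1..l}. m j > 0) \<and> (\<Sum>j\<in>{1..l}. m j) = 1 \<and>
         \<Phi> holomorphic_on (- K) \<and> bij_betw \<Phi> (- K) (- L) \<and>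
         (\<lambda>z. \<Phi> z - z) \<in> O[at_infinity](\<lambda>z. 1 / z) \<and>
         bij_betw L_comp {1..l} (components L) \<and>
         (\<forall>j\<in>{1..l}. \<exists>\<gamma>. surrounds \<gamma> (E j) K \<and> surrounds (\<Phi> \<circ> \<gamma>) (L_comp j) L))"

definition interval_preimage :: "complex poly \<Rightarrow> complex set" where
  "interval_preimage P = poly P -` (complex_of_real ` {-1..1})"

definition num_zeros_in :: "complex poly \<Rightarrow> complex set \<Rightarrow> nat" where
  "num_zeros_in P S = size {#z \<in># proots P. z \<in> S#}"

text \<open>
  \<open>s\<close> is, off \<open>P\<^sup>-\<^sup>1([-1,1])\<close>, the branch of \<open>sqrt (P\<^sup>2 - 1)\<close> that behaves as \<open>P\<close> at \<open>\<infinity>\<close>; its values on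
  \<open>P\<^sup>-\<^sup>1([-1,1])\<close> are unconstrained. The branch is explicitly \<open>(P - 1) * csqrt ((P + 1) / (P - 1))\<close>.
\<close>

definition is_sqrt_branch :: "complex poly \<Rightarrow> (complex \<Rightarrow> complex) \<Rightarrow> bool" where
  "is_sqrt_branch P s \<longleftrightarrow>
     s holomorphic_on (- interval_preimage P) \<and>
     (\<forall>z\<in>- interval_preimage P. (s z)\<^sup>2 = (poly P z)\<^sup>2 - 1) \<and>
     ((\<lambda>z. s z / poly P z) \<longlongrightarrow> 1) at_infinity"

end

theory Submission
  imports Defs
begin

text \<open>
  Put \<open>f = P + sqrt (P\<^sup>2 - 1)\<close> and \<open>U w = (w - a\<^sub>1)^n\<^sub>1 (w - a\<^sub>2)^n\<^sub>2\<close>. Both \<open>ln \<bar>f\<bar> / n\<close> and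
  \<open>m\<^sub>1 ln \<bar>\<Phi> - a\<^sub>1\<bar> + m\<^sub>2 ln \<bar>\<Phi> - a\<^sub>2\<bar> - ln c\<close>, where \<open>c\<close> is the capacity, are Green's function of the complement of \<open>E\<close>, hence equal
  by the maximum principle, so that the capacity never has to be computed. Comparing winding numbers along a curve around \<open>E\<^sub>1\<close>
  gives \<open>m\<^sub>j = n\<^sub>j / n\<close>, so \<open>U (\<Phi> z) = f z / (2 p\<^sub>n)\<close>. The expansion at infinity yields
  \<open>n\<^sub>1 a\<^sub>1 + n\<^sub>2 a\<^sub>2 = - p\<^sub>n\<^sub>-\<^sub>1 / p\<^sub>n\<close>, and at the critical point \<open>\<Phi> z\<^sub>1\<close> is the critical point
  \<open>(n\<^sub>1 a\<^sub>2 + n\<^sub>2 a\<^sub>1) / n\<close> of \<open>U\<close>, which determines \<open>(a\<^sub>2 - a\<^sub>1)^n\<close>.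

  It remains to see that \<open>d = a\<^sub>2 - a\<^sub>1\<close> is real and positive. The point \<open>z\<^sub>1\<close> is the maximum of \<open>\<bar>f\<bar>\<close> on the real gap between
  \<open>E\<^sub>1\<close> and \<open>E\<^sub>2\<close>, and the sign of the second derivative there shows that \<open>\<Phi>' z\<^sub>1\<close> is a real multiple of
  \<open>d\<close>. Hence \<open>\<Phi>\<close> agrees with its reflection in the line through \<open>a\<^sub>1\<close> and \<open>a\<^sub>2\<close>, and comparing both at infinity gives
  that \<open>d\<close> is real. Then \<open>\<Phi>\<close> preserves the upper half plane, and \<open>d < 0\<close> would contradict the winding number
  of \<open>\<Phi> - a\<^sub>1\<close> around \<open>E\<^sub>1\<close>.
\<close>

section \<open>Maximum principle and winding numbers\<close>

text \<open>\<open>loc\<close> encodes harmonicity as being locally a real part, and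
  \<open>bd\<close> bounds upper limits at the frontier, so that no continuous extension of
  \<open>h\<close> is involved. If \<open>h\<close> exceeded \<open>B\<close> somewhere, a
  superlevel set would be compact and a maximum attained; the maximum modulus principle then makes
  \<open>h\<close> constant, contrary to \<open>bd\<close>.\<close>

lemma re_max_principle:
  fixes h :: "complex \<Rightarrow> real"
  assumes "open D" "connected D" "frontier D \<noteq> {}"
    and loc: "\<And>z. z \<in> D \<Longrightarrow> \<exists>r>0. \<exists>g. g holomorphic_on ball z r \<and> (\<forall>w\<in>ball z r. w \<in> D \<and> h w = Re (g w))"
    and inf: "filterlim h at_bot (inf at_infinity (principal D))"
    and bd: "\<And>x M. x \<in> frontier D \<Longrightarrow> B < M \<Longrightarrow> eventually (\<lambda>z. h z < M) (at x within D)"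
    and "z \<in> D"
  shows "h z \<le> B"
proof (rule ccontr)
  assume "\<not> h z \<le> B"
  then have zB: "h z > B" by simp
  define S where "S = {w\<in>D. h w \<ge> h z}"
  have conth: "continuous_on D h"
  proof (subst continuous_on_eq_continuous_at[OF \<open>open D\<close>], intro ballI)
    fix x assume "x \<in> D"
    then obtain r g where r: "r > 0" "g holomorphic_on ball x r" "\<forall>w\<in>ball x r. w \<in> D \<and> h w = Re (g w)"
      using loc by blast
    have "isCont g x"
      using r by (meson centre_in_ball continuous_on_eq_continuous_at holomorphic_on_imp_continuous_on open_ball)
    then have "isCont (\<lambda>w. Re (g w)) x" by (rule isCont_Re)
    moreover have "eventually (\<lambda>w. Re (g w) = h w) (nhds x)"
      using r by (auto simp: eventually_nhds intro!: exI[of _ "ball x r"])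
    ultimately show "isCont h x" by (simp add: isCont_cong)
  qed
  have "eventually (\<lambda>w. h w < h z) (inf at_infinity (principal D))"
    using inf by (auto simp: filterlim_at_bot_dense)
  then obtain R where R: "\<And>w. w \<in> D \<Longrightarrow> R \<le> norm w \<Longrightarrow> h w < h z"
    by (auto simp: eventually_inf_principal eventually_at_infinity)
  have "bounded S"
    unfolding bounded_iff using R by (force simp: S_def not_le intro!: exI[of _ R])
  moreover have "closed S"
  proof (subst closed_limpt, intro allI impI)
    fix x assume x: "x islimpt S"
    then have "x \<in> closure S" by (simp add: closure_def)
    then have xD: "x \<in> closure D" using closure_mono[of S D] by (auto simp: S_def)
    show "x \<in> S"
    proof (cases "x \<in> D")
      case True
      have "continuous (at x within D) h" using conth True by (simp add: continuous_on_eq_continuous_within)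
      then have t: "(h \<longlongrightarrow> h x) (at x within S)"
        unfolding continuous_within by (rule tendsto_within_subset) (auto simp: S_def)
      have "h z \<le> h x"
        by (rule tendsto_lowerbound[OF t]) (use x in \<open>auto simp: S_def eventually_at_filter trivial_limit_within\<close>)
      then show ?thesis using True by (simp add: S_def)
    next
      case False
      then have "x \<in> frontier D" using xD \<open>open D\<close> by (simp add: frontier_def interior_open)
      from bd[OF this zB] have "eventually (\<lambda>w. h w < h z) (at x within D)" .
      then have "eventually (\<lambda>w. h w < h z) (at x within S)"
        by (rule filter_leD[rotated]) (auto intro!: at_le simp: S_def)
      then have "eventually (\<lambda>w. False) (at x within S)"
        unfolding eventually_at_filter by (rule eventually_mono) (auto simp: S_def)
      then show ?thesis using x by (simp add: trivial_limit_within eventually_False)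
    qed
  qed
  ultimately have "compact S" by (simp add: compact_eq_bounded_closed)
  moreover have "S \<noteq> {}" using \<open>z \<in> D\<close> by (auto simp: S_def)
  moreover have "continuous_on S h" by (rule continuous_on_subset[OF conth]) (auto simp: S_def)
  ultimately obtain y where y: "y \<in> S" "\<And>w. w \<in> S \<Longrightarrow> h w \<le> h y"
    using continuous_attains_sup by metis
  have ymax: "h w \<le> h y" if "w \<in> D" for w
    using y that by (cases "h w \<ge> h z") (auto simp: S_def)
  have yD: "y \<in> D" "h y > B" using y zB by (auto simp: S_def)
  \<comment> \<open>The set of maximum points is closed by continuity, and open because
    \<open>exp g\<close> has modulus \<open>exp h\<close>.\<close>
  define Z where "Z = {w\<in>D. h w = h y}"
  have "closedin (top_of_set D) Z"
    unfolding Z_def using continuous_closedin_preimage_constant[OF conth, of "h y"] by simp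
  moreover have "openin (top_of_set D) Z"
  proof (subst openin_open_eq[OF \<open>open D\<close>])
    show "open Z \<and> Z \<subseteq> D"
    proof
      show "Z \<subseteq> D" by (auto simp: Z_def)
      show "open Z" unfolding open_contains_ball
      proof
        fix x assume "x \<in> Z"
        then have x: "x \<in> D" "h x = h y" by (auto simp: Z_def)
        from loc[OF x(1)] obtain r g where r: "r > 0" "g holomorphic_on ball x r"
          "\<And>w. w\<in>ball x r \<Longrightarrow> w \<in> D \<and> h w = Re (g w)" by blast
        have "(\<lambda>w. exp (g w)) constant_on ball x r"
        proof (rule maximum_modulus_principle[where U = "ball x r" and \<xi> = x])
          show "(\<lambda>w. exp (g w)) holomorphic_on ball x r" using r by (intro holomorphic_intros)
          fix w assume "w \<in> ball x r"
          then show "norm (exp (g w)) \<le> norm (exp (g x))"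
            using r(3)[of w] r(3)[of x] r(1) ymax[of w] x by simp
        qed (use r in auto)
        then obtain c where c: "\<And>w. w \<in> ball x r \<Longrightarrow> exp (g w) = c" by (auto simp: constant_on_def)
        have "ball x r \<subseteq> Z"
        proof
          fix w assume w: "w \<in> ball x r"
          have "norm (exp (g w)) = norm (exp (g x))" using c[OF w] c[of x] r(1) by simp
          then show "w \<in> Z" using r(3)[OF w] r(3)[of x] r(1) x by (simp add: Z_def)
        qed
        then show "\<exists>e>0. ball x e \<subseteq> Z" using r(1) by blast
      qed
    qed
  qed
  ultimately have "Z = D"
    using \<open>connected D\<close> yD unfolding connected_clopen by (auto simp: Z_def)
  then have Zeq: "h w = h y" if "w \<in> D" for w using that by (auto simp: Z_def)
  obtain x where x: "x \<in> frontier D" using assms(3) by blast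
  have "eventually (\<lambda>w. h w < h y) (at x within D)" using bd[OF x yD(2)] .
  then have "eventually (\<lambda>w. False) (at x within D)"
    unfolding eventually_at_filter by (rule eventually_mono) (use Zeq in auto)
  moreover have "x islimpt D"
    using x \<open>open D\<close> by (auto simp: frontier_def interior_open closure_def)
  ultimately show False by (simp add: trivial_limit_within eventually_False)
qed

section \<open>Logarithmic derivatives and winding numbers\<close>

text \<open>The real derivative \<open>Re (g' * h)\<close> vanishes in every direction
  \<open>h\<close>; the direction \<open>cnj g'\<close> yields the squared modulus of
  \<open>g'\<close>.\<close>

lemma complex_derivative_zero_if_Re_constant:
  assumes "open S" "z \<in> S" and "\<And>w. w \<in> S \<Longrightarrow> Re (g w) = c" and g: "(g has_field_derivative g') (at z)"
  shows "g' = 0"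
proof -
  have "(g has_derivative (\<lambda>h. g' * h)) (at z)" using g by (simp add: has_field_derivative_def)
  then have "((\<lambda>w. Re (g w)) has_derivative (\<lambda>h. Re (g' * h))) (at z)"
    by (rule has_derivative_Re)
  moreover have "((\<lambda>w. Re (g w)) has_derivative (\<lambda>h. 0)) (at z)"
    by (rule has_derivative_transform_within_open[OF has_derivative_const[of c] assms(1,2)])
       (use assms in auto)
  ultimately have "(\<lambda>h. Re (g' * h)) = (\<lambda>h. 0)" by (rule has_derivative_unique)
  then have "Re (g' * cnj g') = 0" by metis
  then show ?thesis by (simp add: complex_mult_cnj complex_eq_iff sum_power2_eq_zero_iff)
qed

lemma holomorphic_log_on_ball:
  assumes "H holomorphic_on D" "\<And>w. w \<in> D \<Longrightarrow> H w \<noteq> 0" "ball z r \<subseteq> D"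
  obtains l where "l holomorphic_on ball z r" "\<And>w. w \<in> ball z r \<Longrightarrow> H w = exp (l w)"
  using contractible_imp_holomorphic_log[of H "ball z r"] assms
  by (metis convex_ball convex_imp_contractible holomorphic_on_subset subsetD)

text \<open>On a ball all three functions have holomorphic logarithms, and a holomorphic function
  with constant real part has derivative 0. An equation between moduli thus becomes one between
  logarithmic derivatives, without global logarithms.\<close>

lemma log_combination_deriv:
  assumes "open D" "z \<in> D" "F holomorphic_on D" "G holomorphic_on D" "f holomorphic_on D"
    and nz: "\<And>w. w \<in> D \<Longrightarrow> F w \<noteq> 0" "\<And>w. w \<in> D \<Longrightarrow> G w \<noteq> 0" "\<And>w. w \<in> D \<Longrightarrow> f w \<noteq> 0"
    and eq: "\<And>w. w \<in> D \<Longrightarrow> \<alpha> * ln (norm (F w)) + \<beta> * ln (norm (G w)) - ln (norm (f w)) = C"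
  shows "of_real \<alpha> * (deriv F z / F z) + of_real \<beta> * (deriv G z / G z) = deriv f z / f z"
proof -
  obtain r where r: "r > 0" "ball z r \<subseteq> D" using assms(1,2) open_contains_ball by blast
  obtain lF lG lf where l: "lF holomorphic_on ball z r" "lG holomorphic_on ball z r" "lf holomorphic_on ball z r"
     "\<And>w. w \<in> ball z r \<Longrightarrow> F w = exp (lF w)" "\<And>w. w \<in> ball z r \<Longrightarrow> G w = exp (lG w)"
     "\<And>w. w \<in> ball z r \<Longrightarrow> f w = exp (lf w)"
    using holomorphic_log_on_ball[OF assms(3) nz(1) r(2)] holomorphic_log_on_ball[OF assms(4) nz(2) r(2)]
      holomorphic_log_on_ball[OF assms(5) nz(3) r(2)] by metis
  have zin: "z \<in> ball z r" using r by simp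
  have dl: "(l has_field_derivative (deriv H z / H z)) (at z)"
    if l: "l holomorphic_on ball z r" and e: "\<And>w. w \<in> ball z r \<Longrightarrow> H w = exp (l w)" for l H
  proof -
    have d: "(l has_field_derivative deriv l z) (at z)"
      by (rule holomorphic_derivI[OF l open_ball zin])
    have "((\<lambda>w. exp (l w)) has_field_derivative (exp (l z) * deriv l z)) (at z)"
      by (rule DERIV_fun_exp[OF d])
    then have "(H has_field_derivative (exp (l z) * deriv l z)) (at z)"
      by (rule has_field_derivative_transform_within_open[OF _ open_ball zin]) (use e in auto)
    then have "deriv H z = H z * deriv l z" using e[OF zin] DERIV_imp_deriv by metis
    then show ?thesis using d e[OF zin] by simp
  qed
  have d: "((\<lambda>w. of_real \<alpha> * lF w + of_real \<beta> * lG w - lf w) has_field_derivative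
     (of_real \<alpha> * (deriv F z / F z) + of_real \<beta> * (deriv G z / G z) - deriv f z / f z)) (at z)"
    by (intro DERIV_diff DERIV_add DERIV_cmult dl l)
  have "Re (of_real \<alpha> * lF w + of_real \<beta> * lG w - lf w) = C" if w: "w \<in> ball z r" for w
  proof -
    have "w \<in> D" using r w by blast
    from eq[OF this] show ?thesis by (simp add: l(4-6)[OF w])
  qed
  from complex_derivative_zero_if_Re_constant[OF open_ball zin this d] show ?thesis by simp
qed

text \<open>A polynomial loop \<open>p\<close> close to \<open>\<gamma>\<close> is homotopic to it
  in \<open>D\<close>. It is chosen before \<open>F\<close>, so that a linear relation between
  logarithmic derivatives of several functions can be integrated along one and the same path,
  although \<open>\<gamma>\<close> is merely continuous.\<close>

lemma winding_number_compose_holomorphic: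
  assumes "open D" "path \<gamma>" "pathfinish \<gamma> = pathstart \<gamma>" "path_image \<gamma> \<subseteq> D"
  obtains p where "valid_path p" "pathfinish p = pathstart p" "path_image p \<subseteq> D"
    "\<And>F. F holomorphic_on D \<Longrightarrow> (\<And>z. z \<in> D \<Longrightarrow> F z \<noteq> 0) \<Longrightarrow>
       ((\<lambda>z. deriv F z / F z) has_contour_integral (2 * pi * \<i> * winding_number (F \<circ> \<gamma>) 0)) p"
proof -
  obtain e where e: "e > 0" "\<And>h. path h \<Longrightarrow> pathfinish h = pathstart h \<Longrightarrow> (\<And>t. t \<in> {0..1} \<Longrightarrow> norm (h t - \<gamma> t) < e)
      \<Longrightarrow> homotopic_loops D \<gamma> h"
    using homotopic_nearby_loops[OF assms(2,1,4,3)] by metis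
  obtain p where p: "polynomial_function p" "pathstart p = pathstart \<gamma>" "pathfinish p = pathfinish \<gamma>"
     "\<And>t. t \<in> {0..1} \<Longrightarrow> norm (p t - \<gamma> t) < e"
    using path_approx_polynomial_function[OF assms(2) e(1)] by blast
  have vp: "valid_path p" using p(1) valid_path_polynomial_function by blast
  have hl: "homotopic_loops D \<gamma> p"
    using e(2)[of p] p vp valid_path_imp_path assms(3) by metis
  have pD: "path_image p \<subseteq> D" using homotopic_loops_imp_subset[OF hl] by blast
  show ?thesis
  proof
    show "valid_path p" "pathfinish p = pathstart p" "path_image p \<subseteq> D" using vp p pD assms by auto
    fix F assume F: "F holomorphic_on D" "\<And>z. z \<in> D \<Longrightarrow> F z \<noteq> 0"
    have "homotopic_loops (-{0}) (F \<circ> \<gamma>) (F \<circ> p)"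
      by (rule homotopic_loops_continuous_image[OF hl holomorphic_on_imp_continuous_on[OF F(1)]])
         (use F in auto)
    then have "winding_number (F \<circ> \<gamma>) 0 = winding_number (F \<circ> p) 0"
      by (rule winding_number_homotopic_loops)
    also have "\<dots> = 1/(2*pi*\<i>) * contour_integral (F \<circ> p) (\<lambda>w. 1/(w - 0))"
    proof (rule winding_number_valid_path)
      show "valid_path (F \<circ> p)"
        by (rule valid_path_compose_holomorphic[OF vp F(1) \<open>open D\<close> pD])
      show "0 \<notin> path_image (F \<circ> p)" using F pD by (auto simp: path_image_compose)
    qed
    also have "contour_integral (F \<circ> p) (\<lambda>w. 1/(w - 0)) = contour_integral p (\<lambda>w. deriv F w / F w)"
      using contour_integral_comp_analyticW[of F D p "\<lambda>w. 1/(w-0)"] F pD vp \<open>open D\<close>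
      by (simp add: analytic_on_open)
    finally have w: "contour_integral p (\<lambda>w. deriv F w / F w) = 2 * pi * \<i> * winding_number (F \<circ> \<gamma>) 0"
      by (simp add: field_simps del: o_apply)
    have "(\<lambda>w. deriv F w / F w) contour_integrable_on p"
      by (rule contour_integrable_holomorphic_simple[OF _ \<open>open D\<close> vp pD])
         (use F \<open>open D\<close> in \<open>auto intro!: holomorphic_intros\<close>)
    then show "((\<lambda>z. deriv F z / F z) has_contour_integral (2 * pi * \<i> * winding_number (F \<circ> \<gamma>) 0)) p"
      using w has_contour_integral_integral by metis
  qed
qed

text \<open>Continuous logarithms along the two loops add up to one of the product.\<close>

lemma winding_number_mult:
  assumes "path p" "path q" "pathfinish p = pathstart p" "pathfinish q = pathstart q"
    "0 \<notin> path_image p" "0 \<notin> path_image q"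
  shows "winding_number (\<lambda>t. p t * q t) 0 = winding_number p 0 + winding_number q 0"
proof -
  obtain u where u: "path u" "pathfinish u - pathstart u = 2 * of_real pi * \<i> * winding_number p 0"
     "\<And>t. t \<in> {0..1} \<Longrightarrow> p t = 0 + exp (u t)"
    using winding_number_as_continuous_log[OF assms(1,5)] by blast
  obtain v where v: "path v" "pathfinish v - pathstart v = 2 * of_real pi * \<i> * winding_number q 0"
     "\<And>t. t \<in> {0..1} \<Longrightarrow> q t = 0 + exp (v t)"
    using winding_number_as_continuous_log[OF assms(2,6)] by blast
  have pa: "path (\<lambda>t. u t + v t)" using u v by (auto simp: path_def intro: continuous_intros)
  have "winding_number (\<lambda>t. p t * q t) 0 = winding_number (exp \<circ> (\<lambda>t. u t + v t)) 0"
    by (rule winding_number_cong) (simp add: u v exp_add)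
  also have "\<dots> = (pathfinish u - pathstart u + (pathfinish v - pathstart v)) / (2 * of_real pi * \<i>)"
    by (subst winding_number_compose_exp[OF pa]) (simp add: pathfinish_def pathstart_def algebra_simps)
  also have "\<dots> = winding_number p 0 + winding_number q 0"
    by (subst u(2), subst v(2)) (simp add: field_simps)
  finally show ?thesis .
qed

text \<open>The slit plane is simply connected. Applied to a quotient of two functions, this shows
  that they wind equally often around 0.\<close>

lemma winding_number_zero_compl_nonpos_Reals:
  assumes "path \<gamma>" "pathfinish \<gamma> = pathstart \<gamma>" "path_image \<gamma> \<subseteq> - \<real>\<^sub>\<le>\<^sub>0"
  shows "winding_number \<gamma> 0 = 0"
proof (rule simply_connected_imp_winding_number_zero[OF _ assms(1,3,2)])
  have "(\<real>\<^sub>\<le>\<^sub>0 :: complex set) = complex_of_real ` {..0}"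
    by (auto simp: complex_nonpos_Reals_iff complex_eq_iff image_iff)
  then show "simply_connected (- (\<real>\<^sub>\<le>\<^sub>0 :: complex set))"
    by (metis starlike_imp_simply_connected starlike_slotted_complex_plane_left)
qed simp

section \<open>Uniqueness of a lift at a nondegenerate critical value\<close>

text \<open>\<open>T x y\<close> is the divided difference, a symmetric polynomial in
  \<open>x\<close> and \<open>y\<close>, so both its partial derivatives on the diagonal equal half
  the second derivative of \<open>p\<close>. All properties are stated under one existential
  quantifier because the recursion along \<open>pCons\<close> has to deliver them for the same
  \<open>T\<close>.\<close>

lemma poly_divided_difference:
  fixes p :: "complex poly"
  shows "\<exists>T. (\<forall>x y. poly p x - poly p y = (x - y) * T x y) \<and>
     (\<forall>w. T w w = poly (pderiv p) w) \<and>
     (\<forall>X Y X' Y' z. X z = Y z \<longrightarrow> (X has_field_derivative X') (at z) \<longrightarrow> (Y has_field_derivative Y') (at z) \<longrightarrow>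
       ((\<lambda>z. T (X z) (Y z)) has_field_derivative (poly (pderiv (pderiv p)) (X z) / 2 * (X' + Y'))) (at z)) \<and>
     (\<forall>X Y A. X holomorphic_on A \<longrightarrow> Y holomorphic_on A \<longrightarrow> (\<lambda>z. T (X z) (Y z)) holomorphic_on A)"
proof (induction p)
  case 0
  show ?case by (rule exI[of _ "\<lambda>x y. 0"]) simp
next
  case (pCons a p)
  then obtain T where T: "\<And>x y. poly p x - poly p y = (x - y) * T x y" "\<And>w. T w w = poly (pderiv p) w"
    "\<And>X Y X' Y' z. X z = Y z \<Longrightarrow> (X has_field_derivative X') (at z) \<Longrightarrow> (Y has_field_derivative Y') (at z) \<Longrightarrow>
       ((\<lambda>z. T (X z) (Y z)) has_field_derivative (poly (pderiv (pderiv p)) (X z) / 2 * (X' + Y'))) (at z)"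
    "\<And>X Y A. X holomorphic_on A \<Longrightarrow> Y holomorphic_on A \<Longrightarrow> (\<lambda>z. T (X z) (Y z)) holomorphic_on A"
    by blast
  show ?case
  proof (rule exI[of _ "\<lambda>x y. poly p x + y * T x y"], intro conjI allI impI)
    fix x y
    show "poly (pCons a p) x - poly (pCons a p) y = (x - y) * (poly p x + y * T x y)"
      using T(1)[of x y] by (simp add: algebra_simps) (metis (no_types) T(1) add_diff_cancel_left' diff_add_cancel distrib_left mult.left_commute)
  next
    fix w show "poly p w + w * T w w = poly (pderiv (pCons a p)) w" by (simp add: pderiv_pCons T)
  next
    fix X Y :: "complex \<Rightarrow> complex" and X' Y' z
    assume h: "X z = Y z" "(X has_field_derivative X') (at z)" "(Y has_field_derivative Y') (at z)"
    show "((\<lambda>z. poly p (X z) + Y z * T (X z) (Y z)) has_field_derivative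
        poly (pderiv (pderiv (pCons a p))) (X z) / 2 * (X' + Y')) (at z)"
    proof -
      have "((\<lambda>z. poly p (X z)) has_field_derivative poly (pderiv p) (X z) * X') (at z)"
        using DERIV_chain2[OF poly_DERIV h(2)] .
      from DERIV_add[OF this DERIV_mult[OF h(3) T(3)[OF h]]] show ?thesis
        by (rule DERIV_cong) (simp add: T(2) h(1)[symmetric] pderiv_pCons pderiv_add field_simps)
    qed
  next
    fix X Y :: "complex \<Rightarrow> complex" and A assume h: "X holomorphic_on A" "Y holomorphic_on A"
    show "(\<lambda>z. poly p (X z) + Y z * T (X z) (Y z)) holomorphic_on A"
      using h T(4)[OF h] by (intro holomorphic_intros)
  qed
qed

text \<open>At a critical point \<open>U\<close> has two local inverse branches, and the 1-jet
  selects one. In \<open>U (X) - U (Y) = (X - Y) * T (X, Y)\<close> the second factor vanishes at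
  \<open>z\<close> with nonzero derivative, hence is nonzero on a punctured ball. There
  \<open>X = Y\<close>, and the identity theorem extends this to \<open>D\<close>.\<close>

lemma holomorphic_eq_if_poly_eq_at_critical_point:
  fixes U :: "complex poly"
  assumes "open D" "connected D" "z \<in> D" "X holomorphic_on D" "Y holomorphic_on D"
    and eq: "\<And>w. w \<in> D \<Longrightarrow> poly U (X w) = poly U (Y w)"
    and jet: "X z = Y z" "deriv X z = deriv Y z" "deriv X z \<noteq> 0"
    and U: "poly (pderiv U) (X z) = 0" "poly (pderiv (pderiv U)) (X z) \<noteq> 0"
    and "w \<in> D"
  shows "X w = Y w"
proof -
  obtain T where T: "\<And>x y. poly U x - poly U y = (x - y) * T x y" "\<And>w. T w w = poly (pderiv U) w"
    "\<And>X Y X' Y' z. X z = Y z \<Longrightarrow> (X has_field_derivative X') (at z) \<Longrightarrow> (Y has_field_derivative Y') (at z) \<Longrightarrow>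
       ((\<lambda>z. T (X z) (Y z)) has_field_derivative (poly (pderiv (pderiv U)) (X z) / 2 * (X' + Y'))) (at z)"
    "\<And>X Y A. X holomorphic_on A \<Longrightarrow> Y holomorphic_on A \<Longrightarrow> (\<lambda>z. T (X z) (Y z)) holomorphic_on A"
    using poly_divided_difference[of U] by blast
  have dX: "(X has_field_derivative deriv X z) (at z)" and dY: "(Y has_field_derivative deriv Y z) (at z)"
    using assms holomorphic_derivI by blast+
  define S where "S = (\<lambda>z. T (X z) (Y z))"
  have S: "S holomorphic_on D" unfolding S_def by (rule T(4)) fact+
  have "(S has_field_derivative (poly (pderiv (pderiv U)) (X z) / 2 * (deriv X z + deriv Y z))) (at z)"
    unfolding S_def by (rule T(3)[OF jet(1) dX dY])
  moreover have "poly (pderiv (pderiv U)) (X z) / 2 * (deriv X z + deriv Y z) \<noteq> 0"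
    using jet U by simp
  ultimately have "deriv S z \<noteq> 0" using DERIV_imp_deriv by metis
  \<comment> \<open>\<open>isolated_zeros\<close> asks for a point where \<open>S\<close> is
    nonzero; the nonzero derivative supplies it.\<close>
  have "\<exists>b\<in>D. S b \<noteq> 0"
  proof (rule ccontr)
    assume "\<not> (\<exists>b\<in>D. S b \<noteq> 0)"
    then have "(S has_field_derivative 0) (at z)"
      by (intro has_field_derivative_transform_within_open[OF DERIV_const[of 0] \<open>open D\<close> \<open>z \<in> D\<close>]) auto
    then show False using \<open>deriv S z \<noteq> 0\<close> DERIV_imp_deriv by metis
  qed
  then obtain b where b: "b \<in> D" "S b \<noteq> 0" by blast
  have "S z = 0" using T(2) jet U by (simp add: S_def)
  obtain r where r: "0 < r" "ball z r \<subseteq> D" "\<And>x. x \<in> ball z r - {z} \<Longrightarrow> S x \<noteq> 0"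
    using isolated_zeros[OF S assms(1-3) \<open>S z = 0\<close> b] by blast
  have "(\<lambda>w. X w - Y w) w = 0"
  proof (rule analytic_continuation[of "\<lambda>w. X w - Y w" D "ball z r" z w])
    show "(\<lambda>w. X w - Y w) holomorphic_on D" using assms by (intro holomorphic_intros)
    show "z islimpt ball z r" using r(1) by (simp add: islimpt_ball)
    fix x assume x: "x \<in> ball z r"
    show "X x - Y x = 0"
    proof (cases "x = z")
      case False
      then have "S x \<noteq> 0" "x \<in> D" using r x by auto
      then show ?thesis using T(1)[of "X x" "Y x"] eq[of x] by (simp add: S_def)
    qed (use jet in simp)
  qed (use r assms in auto)
  then show ?thesis by simp
qed

section \<open>The branch of the inverse Joukowski map\<close>

lemma compact_interval_preimage:
  assumes "degree P \<ge> 1"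
  shows "compact (interval_preimage P)"
proof -
  have c: "compact (complex_of_real ` {-1..1})"
    by (intro compact_continuous_image continuous_intros) simp
  have "bounded (interval_preimage P)"
  proof -
    have "filterlim (poly P) at_infinity at_infinity"
      by (rule filterlim_poly_at_infinity) (use assms in simp)
    then have "eventually (\<lambda>z. norm (poly P z) > 1) at_infinity"
      by (intro filterlim_at_top_dense[THEN iffD1, rule_format] filterlim_at_infinity_imp_norm_at_top)
    then obtain b where b: "\<And>z. norm z \<ge> b \<Longrightarrow> norm (poly P z) > 1"
      by (auto simp: eventually_at_infinity)
    have "norm z \<le> b" if "z \<in> interval_preimage P" for z
    proof (rule ccontr)
      assume "\<not> norm z \<le> b"
      with b[of z] have "norm (poly P z) > 1" by simp
      with that show False by (auto simp: interval_preimage_def)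
    qed
    then show ?thesis unfolding bounded_iff by blast
  qed
  moreover have "closed (interval_preimage P)"
    unfolding interval_preimage_def
    by (rule continuous_closed_vimage[OF compact_imp_closed[OF c]]) (simp add: poly_isCont)
  ultimately show ?thesis by (simp add: compact_eq_bounded_closed)
qed

text \<open>On the frontier of a bounded component \<open>C\<close> of the complement
  \<open>Im P\<close> vanishes. By the maximum principle for \<open>\<i> * P\<close> and its
  negative it vanishes on \<open>C\<close>, so \<open>P\<close> has derivative 0 there, impossible
  for a nonconstant polynomial.\<close>

lemma connected_compl_interval_preimage:
  assumes "degree P \<ge> 1"
  shows "connected (- interval_preimage P)"
proof (rule ccontr)
  assume nc: "\<not> connected (- interval_preimage P)"
  let ?K = "interval_preimage P"
  have K: "compact ?K" by (rule compact_interval_preimage[OF assms])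
  obtain C where C: "C \<in> components (- ?K)" "bounded C"
    using cobounded_has_bounded_component[OF _ nc] K by (auto simp: compact_imp_bounded)
  have opC: "open C" using open_components[OF _ C(1)] K by (simp add: compact_imp_closed open_Compl)
  have neC: "C \<noteq> {}" using C(1) in_components_nonempty by blast
  have "frontier C \<subseteq> frontier (- ?K)" using frontier_of_components_subset[OF C(1)] .
  also have "\<dots> \<subseteq> ?K" using K by (simp add: frontier_complement compact_imp_closed frontier_subset_closed)
  finally have fr: "Im (poly P z) = 0" if "z \<in> frontier C" for z
    using that by (auto simp: interval_preimage_def)
  have im: "Re (\<i> * poly P z) = 0" if "z \<in> C" for z
  proof -
    have "Re (\<i> * poly P z) \<le> 0"
      by (rule maximum_real_frontier[of "\<lambda>z. \<i> * poly P z" C])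
         (use fr C that in \<open>auto intro!: holomorphic_intros continuous_intros\<close>)
    moreover have "Re (- \<i> * poly P z) \<le> 0"
      by (rule maximum_real_frontier[of "\<lambda>z. - \<i> * poly P z" C])
         (use fr C that in \<open>auto intro!: holomorphic_intros continuous_intros\<close>)
    ultimately show ?thesis by simp
  qed
  have "poly (pderiv P) z = 0" if "z \<in> C" for z
    using complex_derivative_zero_if_Re_constant[OF opC that im DERIV_cmult[OF poly_DERIV]] by simp
  then have "C \<subseteq> {z. poly (pderiv P) z = 0}" by blast
  moreover have "pderiv P \<noteq> 0" using assms by (simp add: pderiv_eq_0_iff)
  ultimately have "finite C" using poly_roots_finite finite_subset by blast
  then show False using opC neC using finite_imp_not_open by blast
qed

text \<open>The Joukowski map takes circles around 0 to ellipses with foci 1 and -1; the right side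
  is the sum of the focal distances. It expresses \<open>norm f\<close> through \<open>p\<close>
  without choosing a root.\<close>

lemma norm_joukowski:
  fixes f p :: complex
  assumes "f \<noteq> 0" "f + 1 / f = 2 * p"
  shows "norm f + 1 / norm f = norm (p - 1) + norm (p + 1)"
proof -
  have "p - 1 = (f - 1)^2 / (2 * f)" "p + 1 = (f + 1)^2 / (2 * f)"
    using assms by (auto simp: field_simps power2_eq_square)
  then have "norm (p - 1) + norm (p + 1) = ((norm (f - 1))^2 + (norm (f + 1))^2) / (2 * norm f)"
    by (simp add: norm_divide norm_power norm_mult add_divide_distrib)
  also have "(norm (f - 1))^2 + (norm (f + 1))^2 = 2 * (norm f)^2 + 2"
    unfolding cmod_power2 by (simp add: power2_eq_square algebra_simps)
  also have "\<dots> / (2 * norm f) = norm f + 1 / norm f"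
    using assms by (simp add: field_simps power2_eq_square)
  finally show ?thesis ..
qed

text \<open>The equation factors as \<open>(u - v) * (u * v - 1) = 0\<close>.\<close>

lemma joukowski_inj:
  fixes u v :: complex
  assumes "norm u > 1" "norm v > 1" "u + 1 / u = v + 1 / v"
  shows "u = v"
proof -
  have nz: "u \<noteq> 0" "v \<noteq> 0" using assms by auto
  have "(u - v) * (u * v - 1) = 0"
  proof -
    have "u - v = 1 / v - 1 / u" using assms(3) by (simp add: algebra_simps)
    also have "\<dots> = (u - v) / (u * v)" using nz by (simp add: field_simps)
    finally have "(u - v) * (u * v) = u - v" using nz by (metis no_zero_divisors nonzero_eq_divide_eq)
    then show ?thesis by (simp add: algebra_simps)
  qed
  moreover have "norm (u * v) > 1" using assms by (simp add: norm_mult less_1_mult)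
  then have "u * v \<noteq> 1" by auto
  ultimately show ?thesis by simp
qed

section \<open>The function \<open>f\<close> off \<open>E\<close>: growth, boundary behaviour,
  critical points\<close>

locale joukowski_branch =
  fixes P :: "complex poly" and s :: "complex \<Rightarrow> complex"
  assumes degP: "degree P \<ge> 1" and branch: "is_sqrt_branch P s"
begin

abbreviation K where "K \<equiv> interval_preimage P"
definition f where "f z = poly P z + s z"

lemma compactK: "compact K" by (rule compact_interval_preimage[OF degP])
lemma openD: "open (- K)" using compactK by (simp add: compact_imp_closed open_Compl)
lemma connD: "connected (- K)" by (rule connected_compl_interval_preimage[OF degP])

lemma f_holo: "f holomorphic_on (- K)"
  using branch unfolding is_sqrt_branch_def f_def by (auto intro!: holomorphic_intros)

lemma f_mult: "z \<notin> K \<Longrightarrow> f z * (poly P z - s z) = 1"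
  using branch unfolding is_sqrt_branch_def f_def
  by (auto simp: algebra_simps power2_eq_square)

lemma f_nz: "z \<notin> K \<Longrightarrow> f z \<noteq> 0" using f_mult[of z] by auto

lemma f_joukowski:
  assumes "z \<notin> K" shows "f z + 1 / f z = 2 * poly P z"
proof -
  have "1 / f z = poly P z - s z" using f_mult[OF assms] f_nz[OF assms] by (simp add: field_simps)
  then show ?thesis by (simp add: f_def)
qed

lemma degP0: "degree P > 0" using degP by simp

lemma lead_nz: "lead_coeff P \<noteq> 0" using degP by auto

lemma eventually_notin_K: "eventually (\<lambda>z. z \<notin> K) at_infinity"
proof -
  obtain b where "\<And>z. z \<in> K \<Longrightarrow> norm z \<le> b" using compact_imp_bounded[OF compactK] bounded_iff by metis
  then show ?thesis unfolding eventually_at_infinity by (intro exI[of _ "b+1"]) force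
qed

lemma P_inf: "filterlim (poly P) at_infinity at_infinity"
  by (rule filterlim_poly_at_infinity[OF degP0])

lemma f_over_P: "((\<lambda>z. f z / poly P z) \<longlongrightarrow> 2) at_infinity"
proof -
  have "((\<lambda>z. 1 + s z / poly P z) \<longlongrightarrow> 1 + 1) at_infinity"
    using branch unfolding is_sqrt_branch_def by (intro tendsto_intros) auto
  moreover have "eventually (\<lambda>z. 1 + s z / poly P z = f z / poly P z) at_infinity"
    using filterlim_at_infinity_imp_eventually_ne[OF P_inf, of 0]
    by eventually_elim (simp add: f_def field_simps)
  ultimately show ?thesis using Lim_transform_eventually by fastforce
qed

lemma f_inf: "filterlim f at_infinity at_infinity"
proof -
  have lim: "filterlim (\<lambda>z. f z / poly P z * poly P z) at_infinity at_infinity"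
    by (rule tendsto_mult_filterlim_at_infinity[OF f_over_P _ P_inf]) simp
  have ev: "eventually (\<lambda>z. f z / poly P z * poly P z = f z) at_infinity"
    using filterlim_at_infinity_imp_eventually_ne[OF P_inf, of 0]
    by eventually_elim simp
  show ?thesis by (rule filterlim_cong[OF refl refl ev, THEN iffD1, OF lim])
qed

lemma f_over_pow: "((\<lambda>z. f z / z ^ degree P) \<longlongrightarrow> 2 * lead_coeff P) at_infinity"
proof -
  have "((\<lambda>z. f z / poly P z * (poly P z / z ^ degree P)) \<longlongrightarrow> 2 * lead_coeff P) at_infinity"
    by (intro tendsto_mult f_over_P poly_divide_tendsto_aux)
  moreover have "eventually (\<lambda>z. f z / poly P z * (poly P z / z ^ degree P) = f z / z ^ degree P) at_infinity"
    using filterlim_at_infinity_imp_eventually_ne[OF P_inf, of 0]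
    by eventually_elim simp
  ultimately show ?thesis using Lim_transform_eventually by fastforce
qed

text \<open>On the unit circle \<open>1 / f\<close> is \<open>cnj f\<close>, so \<open>P\<close>
  would equal \<open>Re f\<close> and lie in [-1, 1].\<close>

lemma norm_f_ne_1:
  assumes "z \<notin> K" shows "norm (f z) \<noteq> 1"
proof
  assume 1: "norm (f z) = 1"
  then have "f z * cnj (f z) = 1" by (simp add: complex_norm_square[symmetric])
  then have "1 / f z = cnj (f z)" using f_nz[OF assms] by (simp add: field_simps)
  then have "poly P z = of_real (Re (f z))"
    using f_joukowski[OF assms] by (simp add: complex_add_cnj)
  moreover have "\<bar>Re (f z)\<bar> \<le> 1" using 1 abs_Re_le_cmod[of "f z"] by simp
  ultimately have "z \<in> K" unfolding interval_preimage_def by (auto simp: abs_le_iff)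
  then show False using assms by simp
qed

text \<open>The branch is normalized at infinity only. From there the inequality spreads over the
  connected complement because \<open>norm f\<close> never takes the value 1.\<close>

lemma norm_f_gt_1:
  assumes "z \<notin> K" shows "norm (f z) > 1"
proof (rule ccontr)
  assume "\<not> norm (f z) > 1"
  with norm_f_ne_1[OF assms] have lt: "norm (f z) < 1" by simp
  have "eventually (\<lambda>z. norm (f z) > 1) at_infinity"
    by (intro filterlim_at_top_dense[THEN iffD1, rule_format] filterlim_at_infinity_imp_norm_at_top f_inf)
  then have "eventually (\<lambda>z. norm (f z) > 1 \<and> z \<notin> K) at_infinity"
    using eventually_notin_K by eventually_elim simp
  then obtain y where y: "norm (f y) > 1" "y \<notin> K"
    using eventually_happens'[OF trivial_limit_at_infinity] by blast
  have "connected ((\<lambda>z. norm (f z)) ` (- K))"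
    by (intro connected_continuous_image continuous_intros holomorphic_on_imp_continuous_on f_holo connD)
  then have "1 \<in> (\<lambda>z. norm (f z)) ` (- K)"
    using connectedD_interval[of "(\<lambda>z. norm (f z)) ` (- K)" "norm (f z)" "norm (f y)" 1] lt y assms by auto
  then show False using norm_f_ne_1 by auto
qed

text \<open>The focal sum of \<open>norm_joukowski\<close> is continuous across \<open>K\<close> and
  equals 2 there, while \<open>x + 1 / x\<close> is strictly increasing for
  \<open>x > 1\<close>.\<close>

lemma f_boundary:
  assumes "x \<in> K" "M > 1"
  shows "eventually (\<lambda>z. norm (f z) < M) (at x within - K)"
proof -
  obtain r where r: "poly P x = of_real r" "-1 \<le> r" "r \<le> 1" using assms by (auto simp: interval_preimage_def)
  have "((\<lambda>z. norm (poly P z - 1) + norm (poly P z + 1)) \<longlongrightarrow> norm (poly P x - 1) + norm (poly P x + 1)) (at x within - K)"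
    by (intro tendsto_intros)
  moreover have "norm (poly P x - 1) + norm (poly P x + 1) = 2"
  proof -
    have "poly P x - 1 = of_real (r - 1)" "poly P x + 1 = of_real (r + 1)" using r by auto
    then have "norm (poly P x - 1) = \<bar>r - 1\<bar>" "norm (poly P x + 1) = \<bar>r + 1\<bar>"
      by (metis norm_of_real)+
    then show ?thesis using r by simp
  qed
  moreover have "M + 1 / M > 2"
  proof -
    have "(M - 1) * (M - 1) > 0" using assms by simp
    then show ?thesis using assms by (simp add: field_simps)
  qed
  ultimately have e: "eventually (\<lambda>z. norm (poly P z - 1) + norm (poly P z + 1) < M + 1 / M) (at x within - K)"
    by (intro order_tendstoD(2)[where y = 2]) simp_all
  moreover have "eventually (\<lambda>z. z \<in> - K) (at x within - K)" by (simp add: eventually_at_filter)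
  ultimately show ?thesis
  proof eventually_elim
    case (elim z)
    then have z: "z \<notin> K" by simp
    note g = norm_f_gt_1[OF z]
    have lt: "norm (f z) + 1 / norm (f z) < M + 1 / M"
      using elim norm_joukowski[OF f_nz[OF z] f_joukowski[OF z]] by simp
    show ?case
    proof (rule ccontr)
      assume "\<not> norm (f z) < M"
      then have ge: "norm (f z) \<ge> M" by simp
      have "(norm (f z) - M) * (norm (f z) * M - 1) \<ge> 0"
        using ge g assms by (intro mult_nonneg_nonneg) (auto simp: less_imp_le less_1_mult)
      moreover have "norm (f z) + 1 / norm (f z) - (M + 1 / M) = (norm (f z) - M) * (norm (f z) * M - 1) / (norm (f z) * M)"
        using g assms f_nz[OF z] by (simp add: divide_simps) (simp add: algebra_simps)
      ultimately have "norm (f z) + 1 / norm (f z) - (M + 1 / M) \<ge> 0"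
        using g assms by (simp del: diff_ge_0_iff_ge)
      then show False using lt by simp
    qed
  qed
qed

text \<open>Differentiating \<open>f + 1 / f = 2 * P\<close> gives
  \<open>f' * (1 - 1 / f^2) = 2 * P'\<close>, and the bracket is nonzero because
  \<open>norm f > 1\<close>.\<close>

lemma deriv_f_eq_0_iff:
  assumes "z \<notin> K" shows "deriv f z = 0 \<longleftrightarrow> poly (pderiv P) z = 0"
proof -
  have d: "(f has_field_derivative deriv f z) (at z)"
    using holomorphic_derivI[OF f_holo openD] assms by blast
  have "((\<lambda>z. f z + 1 / f z) has_field_derivative (deriv f z + (0 * f z - 1 * deriv f z) / (f z * f z))) (at z)"
    by (intro DERIV_add DERIV_divide d DERIV_const f_nz assms)
  then have "((\<lambda>z. 2 * poly P z) has_field_derivative (deriv f z + (0 * f z - 1 * deriv f z) / (f z * f z))) (at z)"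
    by (rule has_field_derivative_transform_within_open[OF _ openD]) (use assms f_joukowski in auto)
  moreover have "((\<lambda>z. 2 * poly P z) has_field_derivative (2 * poly (pderiv P) z)) (at z)"
    by (intro DERIV_cmult poly_DERIV)
  ultimately have "deriv f z + (0 * f z - 1 * deriv f z) / (f z * f z) = 2 * poly (pderiv P) z"
    by (rule DERIV_unique)
  then have "deriv f z * (f z * f z - 1) = 2 * poly (pderiv P) z * (f z * f z)"
    using f_nz[OF assms] by (simp add: field_simps)
  moreover have "norm (f z * f z) > 1" using norm_f_gt_1[OF assms] by (simp add: norm_mult less_1_mult)
  then have "f z * f z \<noteq> 1" by auto
  ultimately show ?thesis using f_nz[OF assms] by auto
qed

end

section \<open>Comparison of Green's functions\<close>

lemma poly_prod_mset_linear:
  "poly (\<Prod>x\<in>#A. [:- x, 1:]) z = (\<Prod>x\<in>#A. z - (x :: 'a :: comm_ring_1))"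
  by (induction A) (simp_all add: left_diff_distrib)

lemma winding_number_linear_factors:
  assumes "path \<gamma>" "pathfinish \<gamma> = pathstart \<gamma>" "c \<noteq> 0" "\<And>x. x \<in># A \<Longrightarrow> x \<notin> path_image \<gamma>"
  shows "winding_number (\<lambda>t. c * (\<Prod>x\<in>#A. \<gamma> t - x)) 0 = (\<Sum>x\<in>#A. winding_number \<gamma> x)"
  using assms(4)
proof (induction A)
  case empty
  show ?case using assms(3) by (simp add: winding_number_constI[of c])
next
  case (add x A)
  define p where "p = (\<lambda>t. c * (\<Prod>x\<in>#A. \<gamma> t - x))"
  have cont: "continuous_on {0..1} (\<lambda>t. \<Prod>x\<in>#B. \<gamma> t - x)" for B
    using assms(1) by (induction B) (auto simp: path_def intro!: continuous_intros)
  have pp: "path p" unfolding p_def path_def by (intro continuous_intros cont)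
  have p0: "0 \<notin> path_image p"
    using add.prems assms(3) by (fastforce simp: p_def path_image_def)
  have "winding_number (\<lambda>t. (\<gamma> t - x) * p t) 0 = winding_number (\<lambda>t. \<gamma> t - x) 0 + winding_number p 0"
  proof (rule winding_number_mult)
    show "path (\<lambda>t. \<gamma> t - x)" using assms(1) by (auto simp: path_def intro: continuous_intros)
    show "0 \<notin> path_image (\<lambda>t. \<gamma> t - x)" using add.prems[of x] by (force simp: path_image_def)
  qed (use pp p0 assms in \<open>auto simp: pathfinish_def pathstart_def p_def\<close>)
  also have "winding_number (\<lambda>t. \<gamma> t - x) 0 = winding_number \<gamma> x" by (rule winding_number_offset[symmetric])
  also have "winding_number p 0 = (\<Sum>x\<in>#A. winding_number \<gamma> x)"
    unfolding p_def using add by simp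
  also have "(\<lambda>t. (\<gamma> t - x) * p t) = (\<lambda>t. c * (\<Prod>x\<in>#add_mset x A. \<gamma> t - x))"
    by (simp add: p_def fun_eq_iff mult_ac)
  finally show ?case by simp
qed

text \<open>\<open>c\<close> stands for the capacity, assumed merely nonnegative; that it is
  positive is derived in \<open>c_pos\<close> from the existence of \<open>\<Phi>\<close>.\<close>

locale lemniscatic_map = joukowski_branch P s for P s +
  fixes a1 a2 :: complex and m1 m2 c :: real and \<Phi> :: "complex \<Rightarrow> complex"
  assumes a_ne: "a1 \<noteq> a2" and m_pos: "m1 > 0" "m2 > 0" and m_sum: "m1 + m2 = 1" and c_nonneg: "c \<ge> 0"
    and \<Phi>_holo: "\<Phi> holomorphic_on (- K)"
    and \<Phi>_bij: "bij_betw \<Phi> (- K) (- {w. norm (w - a1) powr m1 * norm (w - a2) powr m2 \<le> c})"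
    and \<Phi>_bigo: "(\<lambda>z. \<Phi> z - z) \<in> O[at_infinity](\<lambda>z. 1 / z)"
begin

abbreviation n where "n \<equiv> degree P"
abbreviation U where "U w \<equiv> norm (w - a1) powr m1 * norm (w - a2) powr m2"

lemma \<Phi>_inj: "inj_on \<Phi> (- K)" using \<Phi>_bij by (rule bij_betw_imp_inj_on)

lemma U_gt: "z \<notin> K \<Longrightarrow> U (\<Phi> z) > c"
  using bij_betwE[OF \<Phi>_bij] by force

lemma U_pos: "z \<notin> K \<Longrightarrow> U (\<Phi> z) > 0" using U_gt[of z] c_nonneg by simp

lemma \<Phi>_ne:
  assumes "z \<notin> K" shows "\<Phi> z - a1 \<noteq> 0" "\<Phi> z - a2 \<noteq> 0"
  using U_pos[OF assms] by force+

lemma eventually_notin_K_at: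
  assumes "eventually Q (at x within - K)" shows "eventually (\<lambda>z. Q z \<and> z \<notin> K) (at x within - K)"
  using assms unfolding eventually_at_filter by eventually_elim simp

lemma ln_f_pos: "z \<notin> K \<Longrightarrow> ln (norm (f z)) > 0" using norm_f_gt_1 by (intro ln_gt_zero)

lemma \<Phi>_tendsto: "((\<lambda>z. \<Phi> z - z) \<longlongrightarrow> 0) at_infinity"
proof -
  obtain C where "eventually (\<lambda>z. norm (\<Phi> z - z) \<le> C * norm (1 / z)) at_infinity"
    using \<Phi>_bigo landau_o.bigE by blast
  moreover have "((\<lambda>z. C * norm (1 / z :: complex)) \<longlongrightarrow> C * norm (0::complex)) at_infinity"
    using tendsto_inverse_0[where 'a = complex]
    by (intro tendsto_intros) (simp add: divide_inverse)
  ultimately show ?thesis using Lim_null_comparison by simp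
qed

lemma \<Phi>_minus_over_z: "((\<lambda>z. (\<Phi> z - a) / z) \<longlongrightarrow> 1) at_infinity"
proof -
  have "((\<lambda>z. ((\<Phi> z - z) - a) * inverse z + 1) \<longlongrightarrow> (0 - a) * 0 + 1) at_infinity"
    by (intro tendsto_intros \<Phi>_tendsto tendsto_inverse_0)
  moreover have "eventually (\<lambda>z. ((\<Phi> z - z) - a) * inverse z + 1 = (\<Phi> z - a) / z) at_infinity"
    using eventually_not_equal_at_infinity[of 0] by eventually_elim (simp add: field_simps)
  ultimately show ?thesis using Lim_transform_eventually by fastforce
qed

text \<open>Near infinity \<open>\<Phi>\<close> is close to the identity, so by Brouwer it already attains every large value there.\<close>

lemma \<Phi>_bounded:
  obtains M where "\<And>z. z \<notin> K \<Longrightarrow> norm z \<le> R \<Longrightarrow> norm (\<Phi> z) \<le> M"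
proof -
  have "eventually (\<lambda>z. norm (\<Phi> z - z) < 1 \<and> z \<notin> K) at_infinity"
    using tendstoD[OF \<Phi>_tendsto, of 1] eventually_notin_K by (auto simp: eventually_conj_iff)
  then obtain b where b: "\<And>z. norm z \<ge> b \<Longrightarrow> norm (\<Phi> z - z) < 1 \<and> z \<notin> K"
    by (auto simp: eventually_at_infinity)
  define M where "M = max b R + 2"
  have "norm (\<Phi> z) \<le> M" if z: "z \<notin> K" "norm z \<le> R" for z
  proof (rule ccontr)
    assume "\<not> norm (\<Phi> z) \<le> M"
    then have big: "norm (\<Phi> z) > M" by simp
    define w where "w = \<Phi> z"
    have far: "norm x > max b R" if "x \<in> cball w 1" for x
    proof -
      have "norm w \<le> norm x + 1" using that norm_triangle_ineq2[of w x] by (simp add: dist_norm)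
      then show ?thesis using big by (simp add: w_def M_def max_def split: if_splits)
    qed
    \<comment> \<open>A fixed point of this map solves \<open>\<Phi> x = w\<close>. By injectivity
      it is \<open>z\<close>, yet it lies outside the disc that contains \<open>z\<close>.\<close>
    obtain x where x: "x \<in> cball w 1" "w - (\<Phi> x - x) = x"
    proof (rule brouwer_ball[of 1 w "\<lambda>x. w - (\<Phi> x - x)"])
      have "cball w 1 \<subseteq> - K" using far b by force
      then show "continuous_on (cball w 1) (\<lambda>x. w - (\<Phi> x - x))"
        using holomorphic_on_imp_continuous_on[OF \<Phi>_holo] by (auto intro!: continuous_intros intro: continuous_on_subset)
      show "(\<lambda>x. w - (\<Phi> x - x)) \<in> cball w 1 \<rightarrow> cball w 1"
      proof (rule Pi_I)
        fix y assume "y \<in> cball w 1"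
        then have "norm (\<Phi> y - y) < 1" using far[of y] b[of y] by simp
        then show "w - (\<Phi> y - y) \<in> cball w 1" by (simp add: dist_norm)
      qed
    qed auto
    have "\<Phi> x = \<Phi> z" using x(2) by (simp add: w_def algebra_simps)
    moreover have "x \<notin> K" using far[OF x(1)] b[of x] by simp
    ultimately have "x = z" using \<Phi>_inj z by (auto simp: inj_on_def)
    then show False using far[OF x(1)] z by simp
  qed
  then show ?thesis using that by blast
qed

text \<open>This is a properness argument, as \<open>\<Phi>\<close> is not known to extend to
  \<open>K\<close>. The part of \<open>M \<le> U\<close> in a large disc is compact inside the image
  of \<open>\<Phi>\<close>; the inverse map carries it to a compact subset of the complement of
  \<open>K\<close>, which stays away from \<open>x\<close>.\<close>

lemma U_boundary:
  assumes "x \<in> K" "M > c"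
  shows "eventually (\<lambda>z. U (\<Phi> z) < M) (at x within - K)"
proof -
  obtain B where B: "\<And>z. z \<notin> K \<Longrightarrow> norm z \<le> norm x + 1 \<Longrightarrow> norm (\<Phi> z) \<le> B" using \<Phi>_bounded by blast
  obtain \<psi> where \<psi>: "\<psi> holomorphic_on (\<Phi> ` (- K))" "\<And>z. z \<in> - K \<Longrightarrow> \<psi> (\<Phi> z) = z"
    using holomorphic_has_inverse[OF \<Phi>_holo openD \<Phi>_inj] by metis
  define T where "T = cball 0 B \<inter> {w. M \<le> U w}"
  have "continuous_on UNIV (\<lambda>w. U w)"
    by (intro continuous_on_mult; rule continuous_on_powr') (use m_pos in \<open>auto intro!: continuous_intros\<close>)
  then have "closed {w. M \<le> U w}" by (simp add: closed_Collect_le)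
  then have "compact T" unfolding T_def by (intro compact_Int_closed compact_cball)
  have T: "T \<subseteq> \<Phi> ` (- K)" using \<Phi>_bij assms by (auto simp: bij_betw_def T_def)
  have "compact (\<psi> ` T)"
    by (intro compact_continuous_image \<open>compact T\<close> continuous_on_subset[OF _ T] holomorphic_on_imp_continuous_on \<psi>)
  then have o: "open (- \<psi> ` T)" by (simp add: compact_imp_closed open_Compl)
  have "x \<notin> \<psi> ` T" using T \<psi>(2) assms by auto
  then have "eventually (\<lambda>z. z \<in> - \<psi> ` T) (nhds x)" using eventually_nhds_in_open[OF o] by simp
  moreover have "eventually (\<lambda>z. z \<in> ball x 1) (nhds x)" by (rule eventually_nhds_in_open) auto
  ultimately show ?thesis unfolding eventually_at_filter
  proof eventually_elim
    case (elim z)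
    show ?case
    proof (intro impI)
      assume z: "z \<in> - K"
      have "norm z \<le> norm x + 1" using elim(2) norm_triangle_ineq2[of z x] by (simp add: dist_norm norm_minus_commute)
      then have "norm (\<Phi> z) \<le> B" using B z by simp
      moreover have "\<Phi> z \<notin> T" using elim(1) \<psi>(2)[OF z] by force
      ultimately show "U (\<Phi> z) < M" by (simp add: T_def)
    qed
  qed
qed

text \<open>Since \<open>\<Phi>\<close> grows like \<open>z\<close> and \<open>f\<close> like a
  multiple of \<open>z ^ n\<close>, the strict inequality \<open>lt\<close> makes \<open>h\<close>
  tend to minus infinity at infinity, so only \<open>K\<close> matters in the maximum principle. The
  borderline case of equality is reached later by perturbing \<open>\<kappa>\<close>.\<close>

lemma harmonic_bound:
  fixes \<alpha> \<beta> \<kappa> B :: real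
  defines "h \<equiv> \<lambda>z. \<alpha> * ln (norm (\<Phi> z - a1)) + \<beta> * ln (norm (\<Phi> z - a2)) - \<kappa> * ln (norm (f z))"
  assumes lt: "\<alpha> + \<beta> < \<kappa> * n"
    and bd: "\<And>x M. x \<in> K \<Longrightarrow> B < M \<Longrightarrow> eventually (\<lambda>z. h z < M) (at x within - K)"
    and z: "z \<notin> K"
  shows "h z \<le> B"
proof (rule re_max_principle[OF openD connD])
  obtain y where "poly P y = 0" using fundamental_theorem_of_algebra[of P] degP constant_degree[of P] by auto
  then have "y \<in> K" by (force simp: interval_preimage_def image_iff intro: bexI[of _ 0])
  then show "frontier (- K) \<noteq> {}" using z by (auto simp: frontier_eq_empty)
  have fr: "frontier (- K) \<subseteq> K" using compactK by (simp add: frontier_complement compact_imp_closed frontier_subset_closed)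
  then show "eventually (\<lambda>z. h z < M) (at x within - K)" if "x \<in> frontier (- K)" "B < M" for x M
    using bd that by blast
  show "z \<in> - K" using z by simp
  show "\<exists>r>0. \<exists>g. g holomorphic_on ball y r \<and> (\<forall>w\<in>ball y r. w \<in> - K \<and> h w = Re (g w))" if y: "y \<in> - K" for y
  proof -
    obtain r where r: "r > 0" "ball y r \<subseteq> - K" using openE[OF openD y] by metis
    have \<Phi>a: "(\<lambda>z. \<Phi> z - a) holomorphic_on - K" for a using \<Phi>_holo by (intro holomorphic_intros)
    obtain l1 where l1: "l1 holomorphic_on ball y r" "\<And>w. w \<in> ball y r \<Longrightarrow> \<Phi> w - a1 = exp (l1 w)"
      by (rule holomorphic_log_on_ball[OF \<Phi>a[of a1] _ r(2)]) (use \<Phi>_ne in auto)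
    obtain l2 where l2: "l2 holomorphic_on ball y r" "\<And>w. w \<in> ball y r \<Longrightarrow> \<Phi> w - a2 = exp (l2 w)"
      by (rule holomorphic_log_on_ball[OF \<Phi>a[of a2] _ r(2)]) (use \<Phi>_ne in auto)
    obtain l3 where l3: "l3 holomorphic_on ball y r" "\<And>w. w \<in> ball y r \<Longrightarrow> f w = exp (l3 w)"
      by (rule holomorphic_log_on_ball[OF f_holo _ r(2)]) (use f_nz in auto)
    show ?thesis
    proof (intro exI conjI ballI)
      show "(\<lambda>w. of_real \<alpha> * l1 w + of_real \<beta> * l2 w - of_real \<kappa> * l3 w) holomorphic_on ball y r"
        using l1(1) l2(1) l3(1) by (intro holomorphic_intros)
      fix w assume w: "w \<in> ball y r"
      show "h w = Re (of_real \<alpha> * l1 w + of_real \<beta> * l2 w - of_real \<kappa> * l3 w)"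
        unfolding h_def l1(2)[OF w] l2(2)[OF w] l3(2)[OF w] by simp
    qed (use r in auto)
  qed
  show "filterlim h at_bot (inf at_infinity (principal (- K)))"
  proof (rule filterlim_mono[OF _ order_refl inf_le1])
    \<comment> \<open>After division by the growth rates \<open>g\<close> converges, and the rest of
      \<open>h\<close> is a negative multiple of \<open>ln (norm z)\<close>.\<close>
    define g where "g z = \<alpha> * ln (norm ((\<Phi> z - a1) / z)) + \<beta> * ln (norm ((\<Phi> z - a2) / z)) - \<kappa> * ln (norm (f z / z ^ n))" for z
    have g: "(g \<longlongrightarrow> \<alpha> * ln (norm (1::complex)) + \<beta> * ln (norm (1::complex)) - \<kappa> * ln (norm (2 * lead_coeff P))) at_infinity"
      unfolding g_def using lead_nz by (intro tendsto_intros \<Phi>_minus_over_z f_over_pow) auto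
    have ln_inf: "filterlim (\<lambda>z::complex. ln (norm z)) at_top at_infinity"
      by (rule filterlim_compose[OF ln_at_top filterlim_norm_at_top])
    have "filterlim (\<lambda>z::complex. (\<alpha> + \<beta> - \<kappa> * n) * ln (norm z)) at_bot at_infinity"
      by (rule filterlim_tendsto_neg_mult_at_bot[OF tendsto_const _ ln_inf]) (use lt in simp)
    then have lim: "filterlim (\<lambda>z. g z + (\<alpha> + \<beta> - \<kappa> * n) * ln (norm z)) at_bot at_infinity"
      by (simp add: filterlim_tendsto_add_at_bot_iff[OF g])
    have ev: "eventually (\<lambda>z. g z + (\<alpha> + \<beta> - \<kappa> * n) * ln (norm z) = h z) at_infinity"
      using eventually_notin_K eventually_not_equal_at_infinity[of 0]
    proof eventually_elim
      case (elim z)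
      have "norm (\<Phi> z - a1) > 0" "norm (\<Phi> z - a2) > 0" "norm (f z) > 0" "norm z > 0"
        using \<Phi>_ne[OF elim(1)] f_nz[OF elim(1)] elim(2) by auto
      then show ?case
        by (simp add: g_def h_def norm_divide norm_power ln_div ln_realpow algebra_simps)
    qed
    show "filterlim h at_bot at_infinity" by (rule filterlim_cong[OF refl refl ev, THEN iffD1, OF lim])
  qed
qed

lemma ln_U: "z \<notin> K \<Longrightarrow> m1 * ln (norm (\<Phi> z - a1)) + m2 * ln (norm (\<Phi> z - a2)) = ln (U (\<Phi> z))"
  using \<Phi>_ne[of z] by (simp add: ln_mult ln_powr)

lemma n_ln_U:
  assumes "z \<notin> K"
  shows "n * m1 * ln (norm (\<Phi> z - a1)) + n * m2 * ln (norm (\<Phi> z - a2)) = n * ln (U (\<Phi> z))"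
  by (subst ln_U[OF assms, symmetric]) (simp add: distrib_left)

text \<open>The surplus weight \<open>\<epsilon>\<close> forces the decay at infinity. As
  \<open>ln (norm f)\<close> is positive, subtracting it preserves the bound at
  \<open>K\<close>.\<close>

lemma upper_bound:
  assumes bd: "\<And>x M. x \<in> K \<Longrightarrow> B < M \<Longrightarrow> eventually (\<lambda>z. n * ln (U (\<Phi> z)) < M) (at x within - K)"
    and z: "z \<notin> K" and \<epsilon>: "\<epsilon> > 0"
  shows "n * ln (U (\<Phi> z)) - (1 + \<epsilon>) * ln (norm (f z)) \<le> B"
proof -
  have eq: "n * m1 * ln (norm (\<Phi> z - a1)) + n * m2 * ln (norm (\<Phi> z - a2)) - (1 + \<epsilon>) * ln (norm (f z))
     = n * ln (U (\<Phi> z)) - (1 + \<epsilon>) * ln (norm (f z))" if "z \<notin> K" for z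
    using n_ln_U[OF that] by simp
  have "n * m1 * ln (norm (\<Phi> z - a1)) + n * m2 * ln (norm (\<Phi> z - a2)) - (1 + \<epsilon>) * ln (norm (f z)) \<le> B"
  proof (rule harmonic_bound[OF _ _ z])
    have "n * m1 + n * m2 = n" using m_sum by (simp flip: distrib_left)
    then show "n * m1 + n * m2 < (1 + \<epsilon>) * n" using \<epsilon> degP by (simp add: algebra_simps)
    fix x M assume "x \<in> K" "B < M"
    from eventually_notin_K_at[OF bd[OF this]]
    have "eventually (\<lambda>z. n * ln (U (\<Phi> z)) < M \<and> z \<notin> K) (at x within - K)" .
    then show "eventually (\<lambda>z. n * m1 * ln (norm (\<Phi> z - a1)) + n * m2 * ln (norm (\<Phi> z - a2)) - (1 + \<epsilon>) * ln (norm (f z)) < M) (at x within - K)"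
    proof eventually_elim
      case (elim z)
      then have "z \<notin> K" by simp
      from ln_f_pos[OF this] have "(1 + \<epsilon>) * ln (norm (f z)) > 0" using \<epsilon> by (intro mult_pos_pos) auto
      then show ?case unfolding eq[OF \<open>z \<notin> K\<close>] using elim by simp
    qed
  qed
  then show ?thesis using eq[OF z] by simp
qed

text \<open>For \<open>c = 0\<close> the function \<open>ln U\<close> would tend to minus infinity
  at \<open>K\<close>, so \<open>upper_bound\<close> would hold with every \<open>B\<close>.\<close>

lemma c_pos: "c > 0"
proof (rule ccontr)
  assume "\<not> c > 0"
  then have c: "c = 0" using c_nonneg by simp
  obtain z where z: "z \<notin> K" using eventually_happens'[OF trivial_limit_at_infinity eventually_notin_K] by blast
  \<comment> \<open>This is one less than the left side of \<open>upper_bound\<close> at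
    \<open>z\<close> for \<open>\<epsilon> = 1\<close>.\<close>
  define B where "B = n * ln (U (\<Phi> z)) - 2 * ln (norm (f z)) - 1"
  have "n * ln (U (\<Phi> z)) - (1 + 1) * ln (norm (f z)) \<le> B"
  proof (rule upper_bound[OF _ z])
    fix x M assume x: "x \<in> K"
    have "eventually (\<lambda>z. U (\<Phi> z) < exp (M / n)) (at x within - K)"
      by (rule U_boundary[OF x]) (simp add: c)
    then have "eventually (\<lambda>z. U (\<Phi> z) < exp (M / n) \<and> z \<notin> K) (at x within - K)"
      by (rule eventually_notin_K_at)
    then show "eventually (\<lambda>z. n * ln (U (\<Phi> z)) < M) (at x within - K)"
    proof eventually_elim
      case (elim z)
      then have "ln (U (\<Phi> z)) < M / n" using U_pos[of z] by (metis exp_less_cancel_iff exp_ln)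
      then show ?case using degP by (simp add: field_simps)
    qed
  qed simp
  then show False by (simp add: B_def)
qed

text \<open>Both inequalities come from the maximum principle for slightly perturbed differences,
  the perturbation tending to 0 at the fixed point \<open>z\<close>.\<close>

lemma green_function_eq:
  assumes z: "z \<notin> K" shows "n * ln (U (\<Phi> z)) - ln (norm (f z)) = n * ln c"
proof (rule antisym)
  show "n * ln (U (\<Phi> z)) - ln (norm (f z)) \<le> n * ln c"
  proof (rule field_le_epsilon)
    fix e :: real assume e: "e > 0"
    note lf = ln_f_pos[OF z]
    \<comment> \<open>With this \<open>\<epsilon>\<close> the perturbation at \<open>z\<close>
      amounts to exactly \<open>e\<close>.\<close>
    have "n * ln (U (\<Phi> z)) - (1 + e / ln (norm (f z))) * ln (norm (f z)) \<le> n * ln c"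
    proof (rule upper_bound[OF _ z])
      fix x M assume x: "x \<in> K" "n * ln c < M"
      have "ln c < M / n" using x(2) degP by (simp add: field_simps)
      then have "c < exp (M / n)" using c_pos by (metis exp_less_cancel_iff exp_ln)
      then have "eventually (\<lambda>z. U (\<Phi> z) < exp (M / n)) (at x within - K)"
        by (rule U_boundary[OF x(1)])
      then have "eventually (\<lambda>z. U (\<Phi> z) < exp (M / n) \<and> z \<notin> K) (at x within - K)"
        by (rule eventually_notin_K_at)
      then show "eventually (\<lambda>z. n * ln (U (\<Phi> z)) < M) (at x within - K)"
      proof eventually_elim
        case (elim z)
        then have "ln (U (\<Phi> z)) < M / n" using U_pos[of z] by (metis exp_less_cancel_iff exp_ln)
        then show ?case using degP by (simp add: field_simps)
      qed
    qed (use e lf in simp)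
    then show "n * ln (U (\<Phi> z)) - ln (norm (f z)) \<le> n * ln c + e" using lf by (simp add: distrib_right)
  qed
  show "n * ln c \<le> n * ln (U (\<Phi> z)) - ln (norm (f z))"
  proof (rule field_le_epsilon)
    fix e :: real assume e: "e > 0"
    note lf = ln_f_pos[OF z]
    \<comment> \<open>Here \<open>ln (norm f)\<close> carries the weight
      \<open>1 - \<epsilon>\<close>: the bound 1/2 keeps the weight positive, the other keeps the
      error at \<open>z\<close> below \<open>e\<close>.\<close>
    define \<epsilon> where "\<epsilon> = min (1/2) (e / ln (norm (f z)))"
    have \<epsilon>: "0 < \<epsilon>" "\<epsilon> < 1" "\<epsilon> * ln (norm (f z)) \<le> e"
    proof -
      show "0 < \<epsilon>" "\<epsilon> < 1" using e lf by (auto simp: \<epsilon>_def)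
      have "\<epsilon> \<le> e / ln (norm (f z))" by (simp add: \<epsilon>_def)
      then show "\<epsilon> * ln (norm (f z)) \<le> e" using lf by (simp add: field_simps)
    qed
    have eq: "(- n * m1) * ln (norm (\<Phi> z - a1)) + (- n * m2) * ln (norm (\<Phi> z - a2)) - (\<epsilon> - 1) * ln (norm (f z))
       = - n * ln (U (\<Phi> z)) + (1 - \<epsilon>) * ln (norm (f z))" if "z \<notin> K" for z
      using n_ln_U[OF that] by (simp add: algebra_simps)
    have "(- n * m1) * ln (norm (\<Phi> z - a1)) + (- n * m2) * ln (norm (\<Phi> z - a2)) - (\<epsilon> - 1) * ln (norm (f z)) \<le> - n * ln c"
    proof (rule harmonic_bound[OF _ _ z])
      have "n * m1 + n * m2 = n" using m_sum by (simp flip: distrib_left)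
      then have "- n * m1 + - n * m2 = - n" by simp
      moreover have "\<epsilon> * n > 0" using \<epsilon> degP by simp
      ultimately show "- n * m1 + - n * m2 < (\<epsilon> - 1) * n" by (simp add: algebra_simps)
      fix x M assume x: "x \<in> K" "- n * ln c < M"
      have "eventually (\<lambda>z. norm (f z) < exp (M + n * ln c)) (at x within - K)"
        by (rule f_boundary[OF x(1)]) (use x in simp)
      then have "eventually (\<lambda>z. norm (f z) < exp (M + n * ln c) \<and> z \<notin> K) (at x within - K)"
        by (rule eventually_notin_K_at)
      then show "eventually (\<lambda>z. (- n * m1) * ln (norm (\<Phi> z - a1)) + (- n * m2) * ln (norm (\<Phi> z - a2)) - (\<epsilon> - 1) * ln (norm (f z)) < M) (at x within - K)"
      proof eventually_elim
        case (elim z)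
        then have z: "z \<notin> K" by simp
        note l = ln_f_pos[OF z]
        have "ln (norm (f z)) < M + n * ln c" using elim f_nz[OF z] by (metis exp_less_cancel_iff exp_ln zero_less_norm_iff)
        moreover have "(1 - \<epsilon>) * ln (norm (f z)) \<le> ln (norm (f z))" using \<epsilon> l by (simp add: algebra_simps)
        moreover have "ln c < ln (U (\<Phi> z))" using U_gt[OF z] c_pos by simp
        then have "n * ln c \<le> n * ln (U (\<Phi> z))" by (intro mult_left_mono) auto
        ultimately show ?case unfolding eq[OF z] by simp
      qed
    qed
    then have "- n * ln (U (\<Phi> z)) + (1 - \<epsilon>) * ln (norm (f z)) \<le> - n * ln c" using eq[OF z] by simp
    then show "n * ln c \<le> n * ln (U (\<Phi> z)) - ln (norm (f z)) + e" using \<epsilon>(3) by (simp add: algebra_simps)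
  qed
qed

section \<open>From Green's function to winding numbers\<close>

lemma log_deriv_m:
  assumes z: "z \<notin> K"
  shows "of_real (n * m1) * (deriv \<Phi> z / (\<Phi> z - a1)) + of_real (n * m2) * (deriv \<Phi> z / (\<Phi> z - a2)) = deriv f z / f z"
proof -
  have d: "deriv (\<lambda>z. \<Phi> z - a) z = deriv \<Phi> z" for a
    using holomorphic_derivI[OF \<Phi>_holo openD] z by (intro DERIV_imp_deriv derivative_eq_intros) auto
  have "of_real (n * m1) * (deriv (\<lambda>z. \<Phi> z - a1) z / (\<Phi> z - a1)) + of_real (n * m2) * (deriv (\<lambda>z. \<Phi> z - a2) z / (\<Phi> z - a2)) = deriv f z / f z"
  proof (rule log_combination_deriv[OF openD])
    fix w assume w: "w \<in> - K"
    then show "n * m1 * ln (norm (\<Phi> w - a1)) + n * m2 * ln (norm (\<Phi> w - a2)) - ln (norm (f w)) = n * ln c"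
      using green_function_eq[of w] n_ln_U[of w] by simp
  qed (use z \<Phi>_holo f_holo \<Phi>_ne f_nz in \<open>auto intro!: holomorphic_intros\<close>)
  then show ?thesis by (simp add: d)
qed

text \<open>Integrating \<open>log_deriv_m\<close> along a common path gives the winding number of
  \<open>f\<close> around 0, which is then compared with that of \<open>P\<close>. For a curve
  around one component this determines the exponent.\<close>

lemma winding_number_m:
  assumes "path \<gamma>" "pathfinish \<gamma> = pathstart \<gamma>" "path_image \<gamma> \<subseteq> - K"
  shows "of_real (n * m1) * winding_number (\<Phi> \<circ> \<gamma>) a1 + of_real (n * m2) * winding_number (\<Phi> \<circ> \<gamma>) a2
     = (\<Sum>x\<in>#proots P. winding_number \<gamma> x)"
proof -
  obtain p where p: "\<And>F. F holomorphic_on (- K) \<Longrightarrow> (\<And>z. z \<in> - K \<Longrightarrow> F z \<noteq> 0) \<Longrightarrow>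
       ((\<lambda>z. deriv F z / F z) has_contour_integral (2 * pi * \<i> * winding_number (F \<circ> \<gamma>) 0)) p"
     "path_image p \<subseteq> - K"
    using winding_number_compose_holomorphic[OF openD assms] by metis
  have d: "deriv (\<lambda>z. \<Phi> z - a) z = deriv \<Phi> z" if "z \<notin> K" for a z
    using holomorphic_derivI[OF \<Phi>_holo openD] that by (intro DERIV_imp_deriv derivative_eq_intros) auto
  let ?W = "\<lambda>a. winding_number ((\<lambda>z. \<Phi> z - a) \<circ> \<gamma>) 0"
  have hF: "((\<lambda>z. deriv (\<lambda>z. \<Phi> z - a1) z / (\<Phi> z - a1)) has_contour_integral (2 * pi * \<i> * ?W a1)) p"
    by (rule p) (use \<Phi>_holo \<Phi>_ne in \<open>auto intro!: holomorphic_intros\<close>)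
  have hG: "((\<lambda>z. deriv (\<lambda>z. \<Phi> z - a2) z / (\<Phi> z - a2)) has_contour_integral (2 * pi * \<i> * ?W a2)) p"
    by (rule p) (use \<Phi>_holo \<Phi>_ne in \<open>auto intro!: holomorphic_intros\<close>)
  have hf: "((\<lambda>z. deriv f z / f z) has_contour_integral (2 * pi * \<i> * winding_number (f \<circ> \<gamma>) 0)) p"
    by (rule p) (use f_holo f_nz in auto)
  have "((\<lambda>z. of_real (n * m1) * (deriv (\<lambda>z. \<Phi> z - a1) z / (\<Phi> z - a1)) + of_real (n * m2) * (deriv (\<lambda>z. \<Phi> z - a2) z / (\<Phi> z - a2)))
      has_contour_integral (of_real (n * m1) * (2 * pi * \<i> * ?W a1) + of_real (n * m2) * (2 * pi * \<i> * ?W a2))) p"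
    by (intro has_contour_integral_add has_contour_integral_lmul hF hG)
  then have "((\<lambda>z. deriv f z / f z)
      has_contour_integral (of_real (n * m1) * (2 * pi * \<i> * ?W a1) + of_real (n * m2) * (2 * pi * \<i> * ?W a2))) p"
    by (rule has_contour_integral_eq) (use p(2) d log_deriv_m in auto)
  from has_contour_integral_unique[OF this hf]
  have "2 * pi * \<i> * (of_real (n * m1) * ?W a1 + of_real (n * m2) * ?W a2) = 2 * pi * \<i> * winding_number (f \<circ> \<gamma>) 0"
    by (simp add: algebra_simps)
  then have "of_real (n * m1) * ?W a1 + of_real (n * m2) * ?W a2 = winding_number (f \<circ> \<gamma>) 0"
    by simp
  moreover have "?W a = winding_number (\<Phi> \<circ> \<gamma>) a" for a
    by (subst (2) winding_number_offset) (simp add: o_def)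
  moreover have "winding_number (f \<circ> \<gamma>) 0 = (\<Sum>x\<in>#proots P. winding_number \<gamma> x)"
  proof -
    \<comment> \<open>This quotient is \<open>1 + 1 / f^2\<close>, which has positive real part as
      \<open>norm f > 1\<close>. Hence \<open>f\<close> and \<open>2 * P\<close> wind equally often
      around 0.\<close>
    let ?g = "\<lambda>z. 2 * poly P z / f z"
    have cf: "continuous_on (path_image \<gamma>) f"
      using holomorphic_on_imp_continuous_on[OF f_holo] assms(3) continuous_on_subset by blast
    have nz: "f z \<noteq> 0" if "z \<in> path_image \<gamma>" for z using f_nz assms(3) that by blast
    have cg: "continuous_on (path_image \<gamma>) ?g" by (intro continuous_intros cf) (use nz in auto)
    have g: "?g z \<notin> \<real>\<^sub>\<le>\<^sub>0" if "z \<in> - K" for z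
    proof -
      have "?g z = 1 + (1 / f z)^2" using f_joukowski[of z] f_nz[of z] that by (simp add: field_simps power2_eq_square)
      moreover have "norm ((1 / f z)^2) < 1" using norm_f_gt_1[of z] that by (auto simp: norm_divide norm_power power_less_one_iff divide_less_eq_1)
      then have "Re ((1 / f z)^2) > -1" using abs_Re_le_cmod[of "(1 / f z)^2"] by linarith
      ultimately have "Re (?g z) > 0" by simp
      then show ?thesis by (auto simp: complex_nonpos_Reals_iff)
    qed
    have pg: "path (?g \<circ> \<gamma>)" "path (f \<circ> \<gamma>)" using path_continuous_image[OF assms(1)] cg cf by auto
    have "winding_number (?g \<circ> \<gamma>) 0 = 0"
      by (rule winding_number_zero_compl_nonpos_Reals[OF pg(1)])
         (use assms g in \<open>auto simp: path_image_compose pathfinish_compose pathstart_compose simp del: o_apply\<close>)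
    moreover have "winding_number (\<lambda>t. (f \<circ> \<gamma>) t * (?g \<circ> \<gamma>) t) 0 = winding_number (f \<circ> \<gamma>) 0 + winding_number (?g \<circ> \<gamma>) 0"
    proof (rule winding_number_mult[OF pg(2,1)])
      show "0 \<notin> path_image (f \<circ> \<gamma>)" using nz by (auto simp: path_image_compose)
      show "0 \<notin> path_image (?g \<circ> \<gamma>)" using g assms(3) unfolding path_image_compose by force
    qed (use assms in \<open>auto simp: pathfinish_compose pathstart_compose\<close>)
    moreover have "winding_number (\<lambda>t. (f \<circ> \<gamma>) t * (?g \<circ> \<gamma>) t) 0
        = winding_number (\<lambda>t. (2 * lead_coeff P) * (\<Prod>x\<in>#proots P. \<gamma> t - x)) 0"
    proof (rule winding_number_cong)
      fix t :: real assume "0 \<le> t" "t \<le> 1"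
      then have "f (\<gamma> t) \<noteq> 0" using nz by (auto simp: path_image_def)
      moreover have "poly P z = lead_coeff P * (\<Prod>x\<in>#proots P. z - x)" for z
        by (subst complex_poly_decompose_multiset[symmetric]) (simp add: poly_prod_mset_linear)
      ultimately show "(f \<circ> \<gamma>) t * (?g \<circ> \<gamma>) t = (2 * lead_coeff P) * (\<Prod>x\<in>#proots P. \<gamma> t - x)"
        by simp
    qed
    moreover have "\<dots> = (\<Sum>x\<in>#proots P. winding_number \<gamma> x)"
    proof (rule winding_number_linear_factors)
      fix x assume "x \<in># proots P"
      then have "poly P x = 0" using lead_nz by auto
      then have "x \<in> K" by (force simp: interval_preimage_def image_iff intro: bexI[of _ 0])
      then show "x \<notin> path_image \<gamma>" using assms(3) by blast
    qed (use assms lead_nz in auto)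
    ultimately show ?thesis by simp
  qed
  ultimately show ?thesis by simp
qed

end

section \<open>The product formula and the expansion at infinity\<close>

text \<open>The logarithmic form avoids the exponent \<open>k - 1\<close> and exhibits the quotient
  \<open>h' / h\<close> that occurs in \<open>log_deriv_n\<close>.\<close>

lemma has_field_derivative_power_log:
  fixes h :: "complex \<Rightarrow> complex"
  assumes "(h has_field_derivative h') (at z)" "h z \<noteq> 0"
  shows "((\<lambda>z. h z ^ k) has_field_derivative (of_nat k * (h' / h z) * h z ^ k)) (at z)"
proof (cases k)
  case (Suc j)
  have "((\<lambda>z. h z ^ k) has_field_derivative (of_nat k * h z ^ (k - 1) * h')) (at z)"
    using assms(1) by (auto intro!: derivative_eq_intros simp: mult_ac)
  then show ?thesis by (rule DERIV_cong) (use assms Suc in \<open>simp add: field_simps\<close>)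
qed simp

text \<open>The exponent \<open>k\<close> may exceed the degree, as when the second coefficient of
  \<open>P\<close> vanishes; then both sides are 0.\<close>

lemma poly_over_power_tendsto:
  fixes Q :: "complex poly"
  assumes "degree Q \<le> k"
  shows "((\<lambda>z. poly Q z / z ^ k) \<longlongrightarrow> coeff Q k) at_infinity"
proof (cases "degree Q = k")
  case True
  then show ?thesis using poly_divide_tendsto_aux[of Q] by simp
next
  case False
  then have lt: "degree Q < k" using assms by simp
  have L: "((\<lambda>z. poly Q z / z ^ degree Q * inverse z ^ (k - degree Q)) \<longlongrightarrow> lead_coeff Q * 0 ^ (k - degree Q)) at_infinity"
    by (intro tendsto_mult tendsto_power poly_divide_tendsto_aux tendsto_inverse_0)
  have ev: "eventually (\<lambda>z. poly Q z / z ^ degree Q * inverse z ^ (k - degree Q) = poly Q z / z ^ k) at_infinity"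
    using eventually_not_equal_at_infinity[of 0]
  proof eventually_elim
    case (elim z)
    have "z ^ k = z ^ degree Q * z ^ (k - degree Q)" using lt by (simp flip: power_add)
    then show ?case by (simp add: power_inverse divide_inverse)
  qed
  have "lead_coeff Q * 0 ^ (k - degree Q) = coeff Q k" using lt by (simp add: coeff_eq_0 zero_power)
  then show ?thesis using Lim_transform_eventually[OF L ev] by simp
qed

text \<open>Convergence of \<open>z * (A z - 1)\<close> to \<open>a\<close> encodes the expansion
  \<open>A z = 1 + a / z + o(1 / z)\<close>.\<close>

lemma first_order_expansion_mult:
  fixes A B :: "complex \<Rightarrow> complex"
  assumes A: "((\<lambda>z. z * (A z - 1)) \<longlongrightarrow> a) at_infinity" and B: "((\<lambda>z. z * (B z - 1)) \<longlongrightarrow> b) at_infinity"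
  shows "((\<lambda>z. z * (A z * B z - 1)) \<longlongrightarrow> a + b) at_infinity"
proof -
  have "((\<lambda>z. z * (A z - 1) + z * (B z - 1) + (z * (A z - 1)) * (z * (B z - 1)) * inverse z) \<longlongrightarrow> a + b + a * b * 0) at_infinity"
    by (intro tendsto_intros A B tendsto_inverse_0)
  moreover have "eventually (\<lambda>z. z * (A z - 1) + z * (B z - 1) + (z * (A z - 1)) * (z * (B z - 1)) * inverse z
      = z * (A z * B z - 1)) at_infinity"
    using eventually_not_equal_at_infinity[of 0] by eventually_elim (simp add: field_simps)
  ultimately show ?thesis by (simp add: tendsto_cong)
qed

lemma first_order_expansion_power:
  fixes A :: "complex \<Rightarrow> complex"
  assumes A: "((\<lambda>z. z * (A z - 1)) \<longlongrightarrow> a) at_infinity"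
  shows "((\<lambda>z. z * (A z ^ k - 1)) \<longlongrightarrow> of_nat k * a) at_infinity"
proof (induction k)
  case (Suc k)
  from first_order_expansion_mult[OF A this] show ?case by (simp add: algebra_simps)
qed simp

text \<open>Since \<open>r' x = 0\<close>, a positive \<open>r''\<close> would make
  \<open>r'\<close> positive just to the right of \<open>x\<close>, and \<open>r\<close> would rise
  above its maximum.\<close>

lemma second_derivative_nonpos_at_max:
  fixes r :: "real \<Rightarrow> real"
  assumes "u < x" "x < v" and r: "\<And>y. u < y \<Longrightarrow> y < v \<Longrightarrow> (r has_field_derivative r' y) (at y)"
    and max: "\<And>y. u < y \<Longrightarrow> y < v \<Longrightarrow> r y \<le> r x"
    and r': "(r' has_field_derivative r'') (at x)"
  shows "r'' \<le> 0"
proof (rule ccontr)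
  assume "\<not> r'' \<le> 0"
  then have pos: "r'' > 0" by simp
  have "r' x = 0"
    using DERIV_local_max[OF r[OF assms(1,2)], of "min (x - u) (v - x)"] assms by (auto simp: abs_if split: if_splits)
  obtain e where e: "e > 0" "\<And>h. h > 0 \<Longrightarrow> h < e \<Longrightarrow> r' x < r' (x + h)"
    using DERIV_pos_inc_right[OF r' pos] by auto
  define h where "h = min (e / 2) ((v - x) / 2)"
  have h: "0 < h" "h < e" "x + h < v" using e assms by (auto simp: h_def min_def field_simps)
  have der: "\<exists>l. (r has_real_derivative l) (at y) \<and> 0 < l" if y: "x < y" "y < x + h" for y
    using r[of y] e(2)[of "y - x"] h assms y \<open>r' x = 0\<close> by (intro exI[of _ "r' y"]) auto
  have "continuous_on {x..x + h} r"
    using r h assms by (intro continuous_at_imp_continuous_on ballI DERIV_isCont) fastforce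
  then have "r x < r (x + h)"
    using h(1) by (intro DERIV_pos_imp_increasing_open[of x "x + h" r] der) simp_all
  then show False using max[of "x + h"] h assms(1) by linarith
qed

text \<open>By hypothesis \<open>H\<close> coincides with its reflection
  \<open>\<sigma> * cnj (H (cnj w))\<close>, whose derivative is the reflected derivative. The
  conclusion has the form of the hypothesis, so the lemma can be iterated.\<close>

lemma deriv_cnj_symmetric:
  assumes "open D" "H holomorphic_on D" "\<And>z. z \<in> D \<Longrightarrow> cnj z \<in> D" "cnj \<sigma> = \<sigma>"
    and "\<And>z. z \<in> D \<Longrightarrow> H (cnj z) = \<sigma> * cnj (H z)" and "z \<in> D"
  shows "deriv H (cnj z) = \<sigma> * cnj (deriv H z)"
proof -
  have "(H has_field_derivative deriv H z) (at (cnj (cnj z)))"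
    using assms holomorphic_derivI by auto
  from has_field_derivative_cnj_cnj[OF this]
  have d: "((\<lambda>w. \<sigma> * (cnj \<circ> H \<circ> cnj) w) has_field_derivative (\<sigma> * cnj (deriv H z))) (at (cnj z))"
    by (rule DERIV_cmult)
  have eq: "\<sigma> * cnj (H (cnj w)) = H w" if "w \<in> D" for w
    using assms(5)[OF assms(3)[OF that]] by simp
  have "(H has_field_derivative (\<sigma> * cnj (deriv H z))) (at (cnj z))"
    by (rule has_field_derivative_transform_within_open[OF d assms(1)])
       (use assms(3,6) in \<open>simp_all add: eq\<close>)
  then show ?thesis by (rule DERIV_imp_deriv)
qed

lemma poly_cnj_coeff:
  assumes "\<And>j. cnj (coeff Q j) = \<sigma> * coeff Q j"
  shows "cnj (poly Q z) = \<sigma> * poly Q (cnj z)"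
proof -
  have "map_poly cnj Q = smult \<sigma> Q" by (rule poly_eqI) (simp add: coeff_map_poly assms)
  then show ?thesis by (simp add: poly_cnj)
qed

text \<open>Since the multiples \<open>n * m1\<close> and \<open>n * m2\<close> are natural numbers,
  the \<open>n\<close>-th power of the multivalued product is a genuine polynomial in
  \<open>\<Phi>\<close>.\<close>

locale lemniscatic_pair = lemniscatic_map P s a1 a2 m1 m2 c \<Phi> for P s a1 a2 m1 m2 c \<Phi> +
  fixes n1 n2 :: nat
  assumes nm: "degree P * m1 = n1" "degree P * m2 = n2"
begin

lemma n_sum: "n = n1 + n2"
proof -
  have "real n = n * m1 + n * m2" using m_sum by (simp flip: distrib_left)
  then have "real n = real (n1 + n2)" using nm by simp
  then show ?thesis by linarith
qed

lemma n12_pos: "n1 > 0" "n2 > 0"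
  using nm m_pos degP by (metis degP0 gr0I mult_pos_pos of_nat_0 of_nat_0_less_iff order_less_irrefl)+

lemma deriv_\<Phi>: "z \<notin> K \<Longrightarrow> (\<Phi> has_field_derivative deriv \<Phi> z) (at z)"
  using holomorphic_derivI[OF \<Phi>_holo openD] by simp

lemma deriv_f: "z \<notin> K \<Longrightarrow> (f has_field_derivative deriv f z) (at z)"
  using holomorphic_derivI[OF f_holo openD] by simp

lemma log_deriv_n:
  assumes "z \<notin> K"
  shows "of_nat n1 * (deriv \<Phi> z / (\<Phi> z - a1)) + of_nat n2 * (deriv \<Phi> z / (\<Phi> z - a2)) = deriv f z / f z"
  using log_deriv_m[OF assms] unfolding nm by simp

text \<open>Both sides have the same logarithmic derivative, so their quotient is constant on the
  connected complement of \<open>K\<close>; the constant is read off at infinity.\<close>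

lemma product_formula:
  assumes z: "z \<notin> K"
  shows "(\<Phi> z - a1) ^ n1 * (\<Phi> z - a2) ^ n2 = f z / (2 * lead_coeff P)"
proof -
  define T where "T z = (\<Phi> z - a1) ^ n1 * (\<Phi> z - a2) ^ n2 / f z" for z
  have "(T has_field_derivative 0) (at z)" if z: "z \<in> - K" for z
  proof -
    have z': "z \<notin> K" using z by simp
    note nz = \<Phi>_ne[OF z'] f_nz[OF z']
    have d: "((\<lambda>z. (\<Phi> z - a) ^ k) has_field_derivative (of_nat k * (deriv \<Phi> z / (\<Phi> z - a)) * (\<Phi> z - a) ^ k)) (at z)"
      if "\<Phi> z - a \<noteq> 0" for a k
      using DERIV_diff[OF deriv_\<Phi>[OF z'] DERIV_const[of a]] by (intro has_field_derivative_power_log that) simp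
    have "(T has_field_derivative (((of_nat n1 * (deriv \<Phi> z / (\<Phi> z - a1)) * (\<Phi> z - a1) ^ n1 * (\<Phi> z - a2) ^ n2
        + of_nat n2 * (deriv \<Phi> z / (\<Phi> z - a2)) * (\<Phi> z - a2) ^ n2 * (\<Phi> z - a1) ^ n1) * f z
        - (\<Phi> z - a1) ^ n1 * (\<Phi> z - a2) ^ n2 * deriv f z) / (f z * f z))) (at z)"
      unfolding T_def by (intro DERIV_divide DERIV_mult d deriv_f z' nz)
    moreover have "(of_nat n1 * (deriv \<Phi> z / (\<Phi> z - a1)) * (\<Phi> z - a1) ^ n1 * (\<Phi> z - a2) ^ n2
        + of_nat n2 * (deriv \<Phi> z / (\<Phi> z - a2)) * (\<Phi> z - a2) ^ n2 * (\<Phi> z - a1) ^ n1) * f z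
        - (\<Phi> z - a1) ^ n1 * (\<Phi> z - a2) ^ n2 * deriv f z
        = (\<Phi> z - a1) ^ n1 * (\<Phi> z - a2) ^ n2 * f z *
          (of_nat n1 * (deriv \<Phi> z / (\<Phi> z - a1)) + of_nat n2 * (deriv \<Phi> z / (\<Phi> z - a2)) - deriv f z / f z)"
    proof -
      have "(p * x * A * B + q * y * B * A) * F - A * B * D = A * B * F * (p * x + q * y - D / F)"
        if "F \<noteq> 0" for p q x y A B D F :: complex
        using that by (simp add: field_simps)
      from this[OF f_nz[OF z']] show ?thesis .
    qed
    ultimately show ?thesis by (simp only: log_deriv_n[OF z']) simp
  qed
  then have "T constant_on (- K)"
    by (rule has_field_derivative_0_imp_constant_on[OF _ connD openD])
  then obtain C where C: "\<And>z. z \<notin> K \<Longrightarrow> T z = C" by (auto simp: constant_on_def)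
  have "((\<lambda>z. ((\<Phi> z - a1) / z) ^ n1 * ((\<Phi> z - a2) / z) ^ n2 / (f z / z ^ n)) \<longlongrightarrow> 1 ^ n1 * 1 ^ n2 / (2 * lead_coeff P)) at_infinity"
    using lead_nz by (intro tendsto_intros \<Phi>_minus_over_z f_over_pow) auto
  moreover have "eventually (\<lambda>z. ((\<Phi> z - a1) / z) ^ n1 * ((\<Phi> z - a2) / z) ^ n2 / (f z / z ^ n) = C) at_infinity"
    using eventually_notin_K eventually_not_equal_at_infinity[of 0]
  proof eventually_elim
    case (elim z)
    have "z ^ n = z ^ n1 * z ^ n2" by (simp add: n_sum power_add)
    then show ?case using C[OF elim(1)] elim(2) by (simp add: T_def power_divide)
  qed
  ultimately have "((\<lambda>z::complex. C) \<longlongrightarrow> 1 / (2 * lead_coeff P)) at_infinity"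
    by (simp add: tendsto_cong)
  then have "C = 1 / (2 * lead_coeff P)"
    using tendsto_unique[OF trivial_limit_at_infinity tendsto_const] by blast
  then show ?thesis using C[OF z] f_nz[OF z] by (simp add: T_def divide_simps)
qed

text \<open>After division by \<open>z ^ n\<close> the coefficients of \<open>1 / z\<close> in the
  product formula are compared. As \<open>\<Phi> z - z\<close> tends to 0, each factor contributes
  only its center; on the other side \<open>f = 2 * P - 1 / f\<close>, and \<open>1 / f\<close> is
  negligible.\<close>

lemma center_sum: "of_nat n1 * a1 + of_nat n2 * a2 = - coeff P (n - 1) / lead_coeff P"
proof -
  have n2: "n \<ge> 2" using n_sum n12_pos by simp
  have e: "((\<lambda>z. z * ((\<Phi> z - a) / z - 1)) \<longlongrightarrow> - a) at_infinity" for a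
  proof -
    have "((\<lambda>z. (\<Phi> z - z) - a) \<longlongrightarrow> 0 - a) at_infinity" by (intro tendsto_intros \<Phi>_tendsto)
    moreover have "eventually (\<lambda>z. (\<Phi> z - z) - a = z * ((\<Phi> z - a) / z - 1)) at_infinity"
      using eventually_not_equal_at_infinity[of 0] by eventually_elim (simp add: field_simps)
    ultimately show ?thesis by (simp add: tendsto_cong)
  qed
  have L: "((\<lambda>z. z * (((\<Phi> z - a1) / z) ^ n1 * ((\<Phi> z - a2) / z) ^ n2 - 1)) \<longlongrightarrow> of_nat n1 * (- a1) + of_nat n2 * (- a2)) at_infinity"
    by (intro first_order_expansion_mult first_order_expansion_power e)
  \<comment> \<open>Removing the leading term isolates the second coefficient, which may be 0; hence
    only a bound on the degree of \<open>Q\<close>.\<close>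
  define Q where "Q = P - monom (lead_coeff P) n"
  have dQ: "degree Q \<le> n - 1"
  proof (rule degree_le, intro allI impI)
    fix i assume "n - 1 < i"
    then show "coeff Q i = 0" by (cases "i = n") (auto simp: Q_def coeff_eq_0)
  qed
  have cQ: "coeff Q (n - 1) = coeff P (n - 1)" using n2 by (simp add: Q_def)
  have f0: "((\<lambda>z. inverse (f z)) \<longlongrightarrow> 0) at_infinity"
    by (rule tendsto_compose_filtermap[THEN iffD2] filterlim_compose[OF tendsto_inverse_0 f_inf])
  have R: "((\<lambda>z. poly Q z / z ^ (n - 1) / lead_coeff P - inverse (f z) * inverse z ^ (n - 1) / (2 * lead_coeff P)) \<longlongrightarrow>
      coeff P (n - 1) / lead_coeff P - 0 * 0 ^ (n - 1) / (2 * lead_coeff P)) at_infinity"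
    using lead_nz by (intro tendsto_intros tendsto_inverse_0 f0 poly_over_power_tendsto[OF dQ, unfolded cQ]) auto
  have ev: "eventually (\<lambda>z. poly Q z / z ^ (n - 1) / lead_coeff P - inverse (f z) * inverse z ^ (n - 1) / (2 * lead_coeff P)
      = z * (((\<Phi> z - a1) / z) ^ n1 * ((\<Phi> z - a2) / z) ^ n2 - 1)) at_infinity"
    using eventually_notin_K eventually_not_equal_at_infinity[of 0]
  proof eventually_elim
    case (elim z)
    have zn: "z ^ n = z * z ^ (n - 1)" using n2 by (simp flip: power_Suc)
    have "z ^ n = z ^ n1 * z ^ n2" by (simp add: n_sum power_add)
    then have "((\<Phi> z - a1) / z) ^ n1 * ((\<Phi> z - a2) / z) ^ n2 = f z / (2 * lead_coeff P) / z ^ n"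
      using product_formula[OF elim(1)] by (simp add: power_divide)
    also have "f z = 2 * poly P z - inverse (f z)"
      using f_joukowski[OF elim(1)] by (simp add: algebra_simps inverse_eq_divide)
    also have "poly P z = poly Q z + lead_coeff P * z ^ n" by (simp add: Q_def poly_monom)
    finally have *: "((\<Phi> z - a1) / z) ^ n1 * ((\<Phi> z - a2) / z) ^ n2 =
       (2 * (poly Q z + lead_coeff P * z ^ n) - inverse (f z)) / (2 * lead_coeff P) / z ^ n" .
    have "z * ((2 * (q + l * (z * y)) - i) / (2 * l) / (z * y) - 1) = q / y / l - i * inverse y / (2 * l)"
      if "l \<noteq> 0" "y \<noteq> 0" for q l y i :: complex
      using that elim(2) by (simp add: field_simps)
    from this[of "lead_coeff P" "z ^ (n - 1)"] show ?case
      unfolding * zn using lead_nz elim(2) by (simp add: power_inverse)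
  qed
  have "((\<lambda>z. z * (((\<Phi> z - a1) / z) ^ n1 * ((\<Phi> z - a2) / z) ^ n2 - 1)) \<longlongrightarrow> coeff P (n - 1) / lead_coeff P) at_infinity"
    using Lim_transform_eventually[OF R ev] by simp
  from tendsto_unique[OF trivial_limit_at_infinity L this]
  have "- (of_nat n1 * a1 + of_nat n2 * a2) = coeff P (n - 1) / lead_coeff P" by simp
  then show ?thesis by (metis minus_divide_left minus_minus)
qed

lemma deriv_\<Phi>_nz: "z \<notin> K \<Longrightarrow> deriv \<Phi> z \<noteq> 0"
  using holomorphic_injective_imp_regular[OF \<Phi>_holo openD \<Phi>_inj] by simp

text \<open>At a critical point \<open>f' = 0\<close> while \<open>\<Phi>' \<noteq> 0\<close> by
  injectivity, so \<open>\<Phi> z\<close> is a zero of the logarithmic derivative of the two-factor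
  polynomial.\<close>

lemma critical_log_deriv:
  assumes z: "z \<notin> K" and c: "poly (pderiv P) z = 0"
  shows "of_nat n1 * (\<Phi> z - a2) + of_nat n2 * (\<Phi> z - a1) = 0"
proof -
  have "deriv f z = 0" using deriv_f_eq_0_iff[OF z] c by simp
  then have "deriv \<Phi> z * (of_nat n1 * (\<Phi> z - a2) + of_nat n2 * (\<Phi> z - a1)) = 0"
  proof -
    have "x * (p * B + q * A) = 0" if "A \<noteq> 0" "B \<noteq> 0" "p * (x / A) + q * (x / B) = 0" for p q x A B :: complex
      using that by (simp add: field_simps)
    from this[OF \<Phi>_ne[OF z]] show ?thesis using log_deriv_n[OF z] \<open>deriv f z = 0\<close> by simp
  qed
  then show ?thesis using deriv_\<Phi>_nz[OF z] by simp
qed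

text \<open>The preceding equation is linear in \<open>\<Phi> z\<close> with coefficient
  \<open>n\<close>, so it determines \<open>\<Phi> z\<close>, and \<open>\<Phi>\<close> is
  injective.\<close>

lemma critical_unique:
  assumes "z \<notin> K" "poly (pderiv P) z = 0" "w \<notin> K" "poly (pderiv P) w = 0"
  shows "z = w"
proof -
  have "(of_nat n :: complex) * \<Phi> z = of_nat n * \<Phi> w"
    using critical_log_deriv[OF assms(1,2)] critical_log_deriv[OF assms(3,4)]
    by (simp add: n_sum algebra_simps)
  then have "\<Phi> z = \<Phi> w" using degP by simp
  then show ?thesis using \<Phi>_inj assms by (auto simp: inj_on_def)
qed

end

section \<open>Reality of the centers\<close>

lemma real_of_square_nonneg:
  fixes w :: complex
  assumes "w^2 = of_real r" "r \<ge> 0"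
  shows "Im w = 0"
proof (rule ccontr)
  assume im: "Im w \<noteq> 0"
  have "Re (w^2) = r" "Im (w^2) = 0" using assms by simp_all
  then have "(Re w)^2 - (Im w)^2 = r" "Re w * Im w = 0" by (auto simp: power2_eq_square)
  with im have "- ((Im w)^2) = r" by simp
  moreover have "(Im w)^2 > 0" using im by simp
  ultimately show False using assms(2) by linarith
qed

text \<open>If \<open>norm H\<close> has a maximum at a point where \<open>H\<close> equals
  \<open>w\<close>, then \<open>Re (H / w)\<close> is at most 1 with equality there. Dividing by
  \<open>w\<close> thus replaces the modulus by a smooth real function.\<close>

lemma has_real_derivative_Re_of_real:
  assumes "(H has_field_derivative H') (at (complex_of_real x))"
  shows "((\<lambda>x. Re (H (complex_of_real x) / w)) has_field_derivative Re (H' / w)) (at x)"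
proof -
  have "((\<lambda>z. H z / w) has_field_derivative (H' / w)) (at (complex_of_real x))"
    by (rule DERIV_cdivide[OF assms])
  then have "((\<lambda>x. H (complex_of_real x) / w) has_vector_derivative (H' / w)) (at x)"
    by (rule has_vector_derivative_real_field)
  then show ?thesis by (rule has_field_derivative_Re)
qed

lemma adjacent_points_of_closed:
  fixes A :: "real set"
  assumes "closed A" "u0 \<in> A" "v0 \<in> A" "u0 < x" "x < v0" "x \<notin> A"
  obtains u v where "u \<in> A" "v \<in> A" "u0 \<le> u" "u < x" "x < v" "v \<le> v0" "\<And>y. u < y \<Longrightarrow> y < v \<Longrightarrow> y \<notin> A"
proof -
  have "compact (A \<inter> {u0..x})" "A \<inter> {u0..x} \<noteq> {}" using assms by (auto intro: closed_Int_compact)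
  then obtain u where u: "u \<in> A \<inter> {u0..x}" "\<And>y. y \<in> A \<inter> {u0..x} \<Longrightarrow> y \<le> u"
    using compact_attains_sup by metis
  have "compact (A \<inter> {x..v0})" "A \<inter> {x..v0} \<noteq> {}" using assms by (auto intro: closed_Int_compact)
  then obtain v where v: "v \<in> A \<inter> {x..v0}" "\<And>y. y \<in> A \<inter> {x..v0} \<Longrightarrow> v \<le> y"
    using compact_attains_inf by metis
  show ?thesis
  proof (rule that[of u v])
    show "u < x" using u assms(6) by (cases "u = x") auto
    show "x < v" using v assms(6) by (cases "v = x") auto
    fix y assume "u < y" "y < v"
    then show "y \<notin> A" using u v by (cases "y \<le> x") force+
  qed (use u v in auto)
qed

text \<open>With \<open>A\<close> the product of the two factors, \<open>U' * A = U * B\<close> for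
  a linear \<open>B\<close> that vanishes at \<open>x\<close>. One more derivative at
  \<open>x\<close> gives \<open>U'' * A = U * B'\<close>, where \<open>B' = n1 + n2\<close> is
  nonzero.\<close>

lemma two_factor_poly_critical_point:
  fixes b1 b2 :: complex and n1 n2 :: nat
  defines "U \<equiv> [:b1, 1:] ^ n1 * [:- b2, 1:] ^ n2"
  assumes x: "x + b1 \<noteq> 0" "x - b2 \<noteq> 0" and crit: "of_nat n1 * (x - b2) + of_nat n2 * (x + b1) = 0" and n: "n1 + n2 > 0"
  shows "poly (pderiv U) x = 0" "poly (pderiv (pderiv U)) x \<noteq> 0"
proof -
  have pw: "pderiv (p ^ k) * p = of_nat k * pderiv p * p ^ k" for p :: "complex poly" and k
  proof (cases k)
    case (Suc j)
    show ?thesis unfolding Suc pderiv_power_Suc by (simp add: of_nat_poly mult_ac del: of_nat_Suc)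
  qed simp
  define A B where "A = [:b1, 1:] * [:- b2, 1:]" and "B = of_nat n1 * [:- b2, 1:] + of_nat n2 * [:b1, 1:]"
  have "(p * dq + q * dp) * (a * b) = (dp * a) * (q * b) + (dq * b) * (p * a)" for p q dp dq a b :: "complex poly"
    by (simp add: algebra_simps)
  then have "pderiv U * A = (pderiv ([:b1, 1:] ^ n1) * [:b1, 1:]) * ([:- b2, 1:] ^ n2 * [:- b2, 1:])
        + (pderiv ([:- b2, 1:] ^ n2) * [:- b2, 1:]) * ([:b1, 1:] ^ n1 * [:b1, 1:])"
    unfolding U_def A_def pderiv_mult by blast
  also have "\<dots> = U * B"
  proof -
    have "pderiv [:b, 1:] = (1 :: complex poly)" for b by (simp add: pderiv_pCons)
    moreover have "(k * 1 * p) * (q * b) + (l * 1 * q) * (p * a) = (p * q) * (k * b + l * a)"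
      for k l p q a b :: "complex poly" by (simp add: algebra_simps)
    ultimately show ?thesis unfolding pw U_def B_def by presburger
  qed
  finally have UAB: "pderiv U * A = U * B" .
  have e: "poly (pderiv U) y * poly A y = poly U y * poly B y" for y
    using arg_cong[OF UAB, of "\<lambda>p. poly p y"] by (simp only: poly_mult)
  have "poly A x = (x + b1) * (x - b2)" by (simp add: A_def algebra_simps)
  then have "poly A x \<noteq> 0" using x by simp
  have "poly B x = 0" using crit by (simp add: B_def algebra_simps)
  show 0: "poly (pderiv U) x = 0" using e[of x] \<open>poly A x \<noteq> 0\<close> \<open>poly B x = 0\<close> by simp
  have "poly (pderiv (pderiv U * A)) x = poly (pderiv (U * B)) x" using UAB by simp
  then have "poly (pderiv (pderiv U)) x * poly A x = poly U x * poly (pderiv B) x"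
    by (simp add: pderiv_mult 0 \<open>poly B x = 0\<close> mult.commute)
  moreover have "pderiv B = of_nat (n1 + n2)"
    by (simp add: B_def of_nat_poly pderiv_pCons)
  moreover have "poly U x = (x + b1) ^ n1 * (x - b2) ^ n2" by (simp add: U_def poly_power add.commute)
  then have "poly U x \<noteq> 0" using x by simp
  moreover have "poly (of_nat (n1 + n2) :: complex poly) x \<noteq> 0" using n by (simp del: of_nat_add)
  ultimately show "poly (pderiv (pderiv U)) x \<noteq> 0" by auto
qed

section \<open>Reflection in the real axis and the real gap\<close>

text \<open>\<open>\<sigma>\<close> unites the two cases: 1 for real and -1 for purely imaginary
  coefficients. The two components are represented by a real point of each, with a gap between the
  points.\<close>

locale symmetric_lemniscatic_pair = lemniscatic_pair P s a1 a2 m1 m2 c \<Phi> n1 n2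
  for P s a1 a2 m1 m2 c \<Phi> n1 n2 +
  fixes \<sigma> z1 :: complex and e1 e2 :: real
  assumes \<sigma>: "\<sigma> = 1 \<or> \<sigma> = -1" and coeff_cnj: "\<And>j. cnj (coeff P j) = \<sigma> * coeff P j"
    and z1: "z1 \<notin> interval_preimage P" "poly (pderiv P) z1 = 0"
    and e: "complex_of_real e1 \<in> interval_preimage P" "complex_of_real e2 \<in> interval_preimage P"
    and gap: "\<exists>x. e1 < x \<and> x < e2 \<and> complex_of_real x \<notin> interval_preimage P"
begin

lemma \<sigma>_simps [simp]: "\<sigma> * \<sigma> = 1" "cnj \<sigma> = \<sigma>" "\<sigma> \<noteq> 0" "norm \<sigma> = 1" "1 / \<sigma> = \<sigma>" using \<sigma> by auto

lemma P_cnj: "cnj (poly P z) = \<sigma> * poly P (cnj z)" by (rule poly_cnj_coeff) (rule coeff_cnj)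

lemma P_cnj': "poly P (cnj z) = \<sigma> * cnj (poly P z)"
proof -
  have "\<sigma> * cnj (poly P z) = (\<sigma> * \<sigma>) * poly P (cnj z)" unfolding P_cnj by (simp only: mult.assoc)
  then show ?thesis by simp
qed

lemma K_cnj: "cnj z \<in> K \<longleftrightarrow> z \<in> K"
proof -
  have "cnj z \<in> K" if "z \<in> K" for z
  proof -
    obtain r where r: "poly P z = of_real r" "-1 \<le> r" "r \<le> 1" using \<open>z \<in> K\<close> by (auto simp: interval_preimage_def)
    have "poly P (cnj z) = of_real r \<or> poly P (cnj z) = of_real (- r)" using \<sigma> r P_cnj'[of z] by auto
    then show ?thesis using r unfolding interval_preimage_def by force
  qed
  from this[of z] this[of "cnj z"] show ?thesis by auto
qed

text \<open>Both sides lie outside the unit disc and have the same image under the Joukowski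
  map.\<close>

lemma f_cnj:
  assumes "z \<notin> K" shows "f (cnj z) = \<sigma> * cnj (f z)"
proof (rule joukowski_inj)
  have z': "cnj z \<notin> K" using assms K_cnj by simp
  show "norm (f (cnj z)) > 1" "norm (\<sigma> * cnj (f z)) > 1"
    using norm_f_gt_1[OF assms] norm_f_gt_1[OF z'] by (simp_all add: norm_mult)
  have "\<sigma> * cnj (f z) + 1 / (\<sigma> * cnj (f z)) = \<sigma> * cnj (f z + 1 / f z)"
    using \<sigma> by (elim disjE) simp_all
  also have "\<dots> = f (cnj z) + 1 / f (cnj z)"
    unfolding f_joukowski[OF assms] f_joukowski[OF z'] P_cnj' by simp
  finally show "f (cnj z) + 1 / f (cnj z) = \<sigma> * cnj (f z) + 1 / (\<sigma> * cnj (f z))" ..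
qed

lemma D_cnj: "z \<in> - K \<Longrightarrow> cnj z \<in> - K" using K_cnj by simp

lemma deriv_f_cnj: "z \<in> - K \<Longrightarrow> deriv f (cnj z) = \<sigma> * cnj (deriv f z)"
  by (rule deriv_cnj_symmetric[OF openD f_holo D_cnj]) (auto simp: f_cnj)

lemma deriv2_f_cnj: "z \<in> - K \<Longrightarrow> deriv (deriv f) (cnj z) = \<sigma> * cnj (deriv (deriv f) z)"
  by (rule deriv_cnj_symmetric[OF openD holomorphic_deriv[OF f_holo openD] D_cnj]) (auto simp: deriv_f_cnj)

lemma z1_real: "cnj z1 = z1"
proof (rule critical_unique)
  have "cnj (poly (pderiv P) z1) = \<sigma> * poly (pderiv P) (cnj z1)"
    by (rule poly_cnj_coeff) (simp add: coeff_pderiv coeff_cnj)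
  then show "poly (pderiv P) (cnj z1) = 0" using z1 by simp
qed (use z1 K_cnj in auto)

abbreviation x1 where "x1 \<equiv> Re z1"

lemma z1_eq [simp]: "complex_of_real x1 = z1"
  using z1_real by (simp add: complex_eq_iff)

text \<open>Inside a bounded real gap \<open>norm f\<close> exceeds 1 and it tends to 1 at the ends,
  so it has an interior maximum \<open>y\<close>. There \<open>f' / f\<close> has real part 0 and is
  real by symmetry, so \<open>y\<close> is critical and equals \<open>z1\<close> by uniqueness. In
  particular every bounded real gap contains \<open>x1\<close>.\<close>

lemma gap_max:
  assumes uv: "complex_of_real u \<in> K" "complex_of_real v \<in> K" "u < v"
    and free: "\<And>x. u < x \<Longrightarrow> x < v \<Longrightarrow> complex_of_real x \<notin> K"
  shows "u < x1 \<and> x1 < v \<and> (\<forall>x. u < x \<longrightarrow> x < v \<longrightarrow> norm (f (complex_of_real x)) \<le> norm (f z1))"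
proof -
  define x0 where "x0 = (u + v) / 2"
  have x0: "u < x0" "x0 < v" using uv by (auto simp: x0_def)
  note g0 = norm_f_gt_1[OF free[OF x0]]
  obtain d1 where d1: "d1 > 0" "\<And>z. z \<notin> K \<Longrightarrow> dist z (complex_of_real u) < d1 \<Longrightarrow> norm (f z) < norm (f (complex_of_real x0))"
    using f_boundary[OF uv(1) g0] uv(1) unfolding eventually_at by (metis ComplI)
  obtain d2 where d2: "d2 > 0" "\<And>z. z \<notin> K \<Longrightarrow> dist z (complex_of_real v) < d2 \<Longrightarrow> norm (f z) < norm (f (complex_of_real x0))"
    using f_boundary[OF uv(2) g0] uv(2) unfolding eventually_at by (metis ComplI)
  \<comment> \<open>Outside \<open>[u', v']\<close> the modulus is below its value at the midpoint
    \<open>x0\<close>, so the maximum over this compact interval is the maximum over the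
    gap.\<close>
  define u' v' where "u' = u + min d1 (x0 - u) / 2" and "v' = v - min d2 (v - x0) / 2"
  have u': "u < u'" "u' \<le> x0" "u' - u < d1" and v': "v' < v" "x0 \<le> v'" "v - v' < d2"
    using x0 d1(1) d2(1) by (auto simp: u'_def v'_def min_def field_simps)
  have "continuous_on {u'..v'} (\<lambda>x. norm (f (complex_of_real x)))"
    using free u' v' by (intro continuous_intros continuous_on_compose2[OF holomorphic_on_imp_continuous_on[OF f_holo]]) auto
  then obtain y where y: "u' \<le> y" "y \<le> v'" "\<And>x. u' \<le> x \<Longrightarrow> x \<le> v' \<Longrightarrow> norm (f (complex_of_real x)) \<le> norm (f (complex_of_real y))"
    using continuous_attains_sup[of "{u'..v'}" "\<lambda>x. norm (f (complex_of_real x))"] u' v' by auto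
  have yuv: "u < y" "y < v" using y u' v' by auto
  have max: "norm (f (complex_of_real x)) \<le> norm (f (complex_of_real y))" if x: "u < x" "x < v" for x
  proof -
    consider "x < u'" | "u' \<le> x" "x \<le> v'" | "v' < x" by linarith
    then show ?thesis
    proof cases
      case 1
      then have "norm (f (complex_of_real x)) < norm (f (complex_of_real x0))"
        using d1(2)[OF free[OF x]] x u' by (simp add: dist_real_def)
      then show ?thesis using y(3)[of x0] u' v' by simp
    next
      case 3
      then have "norm (f (complex_of_real x)) < norm (f (complex_of_real x0))"
        using d2(2)[OF free[OF x]] x v' by (simp add: dist_real_def)
      then show ?thesis using y(3)[of x0] u' v' by simp
    qed (rule y)
  qed
  have yK: "complex_of_real y \<notin> K" using free yuv by blast
  let ?r = "\<lambda>x. Re (f (complex_of_real x) / f (complex_of_real y))"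
  have "(?r has_field_derivative Re (deriv f (complex_of_real y) / f (complex_of_real y))) (at y)"
    by (rule has_real_derivative_Re_of_real[OF deriv_f[OF yK]])
  moreover have "?r x \<le> ?r y" if "\<bar>y - x\<bar> < min (y - u) (v - y)" for x
  proof -
    have "u < x" "x < v" using that by auto
    then have "norm (f (complex_of_real x) / f (complex_of_real y)) \<le> 1"
      using max f_nz[OF yK] by (simp add: norm_divide)
    then have "?r x \<le> 1" using complex_Re_le_cmod order_trans by blast
    then show ?thesis using f_nz[OF yK] by simp
  qed
  ultimately have "Re (deriv f (complex_of_real y) / f (complex_of_real y)) = 0"
    using DERIV_local_max[of ?r _ y "min (y - u) (v - y)"] yuv by auto
  moreover have "cnj (deriv f (complex_of_real y) / f (complex_of_real y)) = deriv f (complex_of_real y) / f (complex_of_real y)"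
  proof -
    have "deriv f (complex_of_real y) = \<sigma> * cnj (deriv f (complex_of_real y))" using deriv_f_cnj[of "complex_of_real y"] yK by simp
    moreover have "f (complex_of_real y) = \<sigma> * cnj (f (complex_of_real y))" using f_cnj[OF yK] by simp
    ultimately have "deriv f (complex_of_real y) / f (complex_of_real y) = (\<sigma> * cnj (deriv f (complex_of_real y))) / (\<sigma> * cnj (f (complex_of_real y)))" by metis
    then show ?thesis by simp
  qed
  then have "Im (deriv f (complex_of_real y) / f (complex_of_real y)) = 0" by (metis Reals_cnj_iff complex_is_Real_iff)
  ultimately have "deriv f (complex_of_real y) / f (complex_of_real y) = 0" by (simp only: complex_eq_iff) simp
  then have "deriv f (complex_of_real y) = 0" using f_nz[OF yK] by simp
  then have "poly (pderiv P) (complex_of_real y) = 0" using deriv_f_eq_0_iff[OF yK] by simp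
  then have "complex_of_real y = z1" using critical_unique[OF yK _ z1] by simp
  moreover from this have "y = x1" by (metis Re_complex_of_real)
  ultimately show ?thesis using yuv max by auto
qed

lemma closed_real_K: "closed {x. complex_of_real x \<in> K}"
proof -
  have "closed (complex_of_real -` K)"
    by (rule continuous_closed_vimage[OF compact_imp_closed[OF compactK]]) simp
  then show ?thesis by (simp add: vimage_def)
qed

lemma gap_around:
  assumes "complex_of_real x \<notin> K" "complex_of_real u0 \<in> K" "complex_of_real v0 \<in> K" "u0 < x" "x < v0"
  obtains u v where "u0 \<le> u" "u < x" "x < v" "v \<le> v0" "u < x1" "x1 < v"
    "\<And>y. u < y \<Longrightarrow> y < v \<Longrightarrow> complex_of_real y \<notin> K"
    "\<And>y. u < y \<Longrightarrow> y < v \<Longrightarrow> norm (f (complex_of_real y)) \<le> norm (f z1)"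
proof -
  obtain u v where uv: "complex_of_real u \<in> K" "complex_of_real v \<in> K" "u0 \<le> u" "u < x" "x < v" "v \<le> v0"
     "\<And>y. u < y \<Longrightarrow> y < v \<Longrightarrow> complex_of_real y \<notin> K"
    using adjacent_points_of_closed[OF closed_real_K, of u0 v0 x] assms by auto
  then have "u < v" by simp
  from gap_max[OF uv(1,2) this uv(7)] show ?thesis using uv by (intro that[of u v]) auto
qed

lemma x1_between: "e1 < x1" "x1 < e2"
proof -
  obtain x where x: "e1 < x" "x < e2" "complex_of_real x \<notin> K" using gap by blast
  obtain u v where "e1 \<le> u" "v \<le> e2" "u < x1" "x1 < v"
    using gap_around[OF x(3) e x(1,2)] by metis
  then show "e1 < x1" "x1 < e2" by auto
qed

text \<open>The second derivative test for \<open>Re (f / f z1)\<close> along the gap gives the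
  sign, and reflection symmetry makes the ratio real.\<close>

lemma second_deriv_ratio:
  obtains r where "r \<ge> 0" "deriv (deriv f) z1 / f z1 = - complex_of_real r"
proof -
  have zK: "complex_of_real x1 \<notin> K" using z1 by simp
  obtain u v where uv: "u < x1" "x1 < v" "\<And>y. u < y \<Longrightarrow> y < v \<Longrightarrow> complex_of_real y \<notin> K"
    "\<And>y. u < y \<Longrightarrow> y < v \<Longrightarrow> norm (f (complex_of_real y)) \<le> norm (f z1)"
    using gap_around[OF zK e x1_between] by metis
  have "Re (deriv (deriv f) z1 / f z1) \<le> 0"
  proof (rule second_derivative_nonpos_at_max[OF uv(1,2)])
    show "((\<lambda>x. Re (f (complex_of_real x) / f z1)) has_field_derivative Re (deriv f (complex_of_real y) / f z1)) (at y)"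
      if "u < y" "y < v" for y
      by (rule has_real_derivative_Re_of_real[OF deriv_f[OF uv(3)[OF that]]])
    have "(deriv f has_field_derivative deriv (deriv f) z1) (at (complex_of_real x1))"
      using holomorphic_derivI[OF holomorphic_deriv[OF f_holo openD] openD] z1 by simp
    then show "((\<lambda>x. Re (deriv f (complex_of_real x) / f z1)) has_field_derivative Re (deriv (deriv f) z1 / f z1)) (at x1)"
      by (rule has_real_derivative_Re_of_real)
    fix y assume y: "u < y" "y < v"
    have "norm (f (complex_of_real y) / f z1) \<le> 1"
      using uv(4)[OF y] f_nz[OF z1(1)] by (simp add: norm_divide)
    then have "Re (f (complex_of_real y) / f z1) \<le> 1" using complex_Re_le_cmod order_trans by blast
    then show "Re (f (complex_of_real y) / f z1) \<le> Re (f (complex_of_real x1) / f z1)"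
      using f_nz[OF z1(1)] by simp
  qed
  moreover have "cnj (deriv (deriv f) z1 / f z1) = deriv (deriv f) z1 / f z1"
  proof -
    have "deriv (deriv f) z1 = \<sigma> * cnj (deriv (deriv f) z1)" using deriv2_f_cnj[of z1] z1 z1_real by simp
    moreover have "f z1 = \<sigma> * cnj (f z1)" using f_cnj[OF z1(1)] z1_real by simp
    ultimately have "deriv (deriv f) z1 / f z1 = (\<sigma> * cnj (deriv (deriv f) z1)) / (\<sigma> * cnj (f z1))" by metis
    then show ?thesis by simp
  qed
  then have "Im (deriv (deriv f) z1 / f z1) = 0" by (metis Reals_cnj_iff complex_is_Real_iff)
  ultimately show ?thesis
    by (intro that[of "- Re (deriv (deriv f) z1 / f z1)"]) (auto simp: complex_eq_iff)
qed

definition d where "d = a2 - a1"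

lemma d_nz: "d \<noteq> 0" using a_ne by (simp add: d_def)

lemma n_nz [simp]: "n \<noteq> 0" "0 < n" using degP by simp_all

lemma \<Phi>_z1: "\<Phi> z1 - a1 = of_nat n1 / of_nat n * d" "\<Phi> z1 - a2 = - (of_nat n2 / of_nat n * d)"
proof -
  have "of_nat n * (\<Phi> z1 - a1) = of_nat n1 * d" "of_nat n * (\<Phi> z1 - a2) = - (of_nat n2 * d)"
    using critical_log_deriv[OF z1] by (simp_all add: n_sum d_def algebra_simps)
  then show "\<Phi> z1 - a1 = of_nat n1 / of_nat n * d" "\<Phi> z1 - a2 = - (of_nat n2 / of_nat n * d)"
    by (simp_all add: field_simps)
qed

text \<open>The relation \<open>log_deriv_n\<close>, cleared of denominators, is differentiated at
  \<open>z1\<close>. Since \<open>L\<close> and \<open>f'\<close> both vanish there, only the terms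
  with their derivatives survive.\<close>

lemma \<Phi>'_square: "deriv (deriv f) z1 / f z1 = of_nat n * (deriv \<Phi> z1)^2 / ((\<Phi> z1 - a1) * (\<Phi> z1 - a2))"
proof -
  define L where "L z = of_nat n1 * (\<Phi> z - a2) + of_nat n2 * (\<Phi> z - a1)" for z
  have z1': "z1 \<in> - K" using z1 by simp
  have eq: "L z * (deriv \<Phi> z * f z) = deriv f z * ((\<Phi> z - a1) * (\<Phi> z - a2))" if "z \<in> - K" for z
  proof -
    have "(p * B + q * A) * (x * F) = D * (A * B)"
      if "A \<noteq> 0" "B \<noteq> 0" "F \<noteq> 0" "p * (x / A) + q * (x / B) = D / F" for p q x A B D F :: complex
      using that by (simp add: field_simps)
    from this[OF \<Phi>_ne f_nz log_deriv_n] show ?thesis using that by (simp add: L_def)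
  qed
  have d1: "((\<lambda>z. \<Phi> z - a) has_field_derivative deriv \<Phi> z1) (at z1)" for a
    using DERIV_diff[OF deriv_\<Phi>[OF z1(1)] DERIV_const[of a]] by simp
  have dL: "(L has_field_derivative (of_nat n1 * deriv \<Phi> z1 + of_nat n2 * deriv \<Phi> z1)) (at z1)"
    unfolding L_def by (intro DERIV_add DERIV_cmult d1)
  have d2\<Phi>: "(deriv \<Phi> has_field_derivative deriv (deriv \<Phi>) z1) (at z1)"
    and d2f: "(deriv f has_field_derivative deriv (deriv f) z1) (at z1)"
    using holomorphic_derivI[OF holomorphic_deriv[OF \<Phi>_holo openD] openD z1']
      holomorphic_derivI[OF holomorphic_deriv[OF f_holo openD] openD z1'] by auto
  note lhs = DERIV_mult[OF dL DERIV_mult[OF d2\<Phi> deriv_f[OF z1(1)]]]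
  have rhs: "((\<lambda>z. L z * (deriv \<Phi> z * f z)) has_field_derivative
      (deriv (deriv f) z1 * ((\<Phi> z1 - a1) * (\<Phi> z1 - a2)) + (deriv \<Phi> z1 * (\<Phi> z1 - a2) + deriv \<Phi> z1 * (\<Phi> z1 - a1)) * deriv f z1)) (at z1)"
    by (rule has_field_derivative_transform_within_open[OF DERIV_mult[OF d2f DERIV_mult[OF d1 d1]] openD z1'])
       (simp add: eq)
  have "deriv f z1 = 0" using deriv_f_eq_0_iff[OF z1(1)] z1(2) by simp
  moreover have "L z1 = 0" using critical_log_deriv[OF z1] by (simp add: L_def)
  ultimately have eq: "of_nat n * (deriv \<Phi> z1)^2 * f z1 = deriv (deriv f) z1 * ((\<Phi> z1 - a1) * (\<Phi> z1 - a2))"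
    using DERIV_unique[OF lhs rhs] by (simp add: n_sum power2_eq_square algebra_simps)
  have "D / F = x / C" if "x * F = D * C" "C \<noteq> 0" "F \<noteq> 0" for C D F x :: complex
    using that by (simp add: frac_eq_eq mult.commute)
  from this[OF eq] show ?thesis using \<Phi>_ne[OF z1(1)] f_nz[OF z1(1)] by simp
qed

lemma f_ratio_cnj: "z \<notin> K \<Longrightarrow> cnj (f (cnj z) / (2 * lead_coeff P)) = f z / (2 * lead_coeff P)"
  by (simp add: f_cnj coeff_cnj)

text \<open>This is the mean of the zeros of \<open>P\<close>; by \<open>center_sum\<close> it is
  also the weighted mean of the centers.\<close>

definition t where "t = - coeff P (n - 1) / (of_nat n * lead_coeff P)"

lemma t_cnj: "cnj t = t"
  using \<sigma> by (elim disjE) (simp_all add: t_def coeff_cnj)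

lemma centers: "a1 = t - of_nat n2 / of_nat n * d" "a2 = t + of_nat n1 / of_nat n * d"
proof -
  have "of_nat n * t = of_nat n1 * a1 + of_nat n2 * a2"
    unfolding center_sum using lead_nz by (simp add: t_def)
  then have t: "t = (of_nat n1 * a1 + of_nat n2 * a2) / of_nat n" by (simp add: field_simps)
  show "a1 = t - of_nat n2 / of_nat n * d" "a2 = t + of_nat n1 / of_nat n * d"
    unfolding t d_def by (simp_all add: field_simps) (simp_all add: n_sum algebra_simps)
qed

lemma d_power: "(of_nat n1 / of_nat n * d) ^ n1 * (- (of_nat n2 / of_nat n * d)) ^ n2 = f z1 / (2 * lead_coeff P)"
  using product_formula[OF z1(1)] unfolding \<Phi>_z1 .

text \<open>\<open>d ^ n\<close> is a real multiple of \<open>f z1 / (2 * lead_coeff P)\<close>,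
  where the two factors \<open>\<sigma>\<close> cancel under conjugation. So far this leaves
  finitely many directions for \<open>d\<close>.\<close>

lemma cnj_d_power: "cnj (d ^ n) = d ^ n"
proof -
  define k where "k = (of_nat n1 / of_nat n) ^ n1 * (- (of_nat n2 / of_nat n :: complex)) ^ n2"
  have "k \<noteq> 0" using n12_pos by (simp add: k_def)
  have eq: "k * d ^ n = f z1 / (2 * lead_coeff P)"
    unfolding d_power[symmetric] k_def
    by (simp only: n_sum power_add power_mult_distrib minus_mult_left) (simp add: mult_ac)
  have "cnj (k * d ^ n) = k * d ^ n" unfolding eq using f_ratio_cnj[OF z1(1)] z1_real by simp
  moreover have "cnj k = k" by (simp add: k_def)
  ultimately show ?thesis using \<open>k \<noteq> 0\<close> by simp
qed

text \<open>In the rotated coordinate \<open>X = (\<Phi> - t) / (d / \<bar>d\<bar>)\<close> the product formula has real coefficients, and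
  \<open>X\<close> has a real 1-jet at the critical point since \<open>\<bar>f\<bar>\<close> is maximal there along the real gap.
  So \<open>X\<close> coincides with its reflection, and the behaviour at infinity forces \<open>d / \<bar>d\<bar>\<close> to be real.\<close>

lemma d_real: "cnj d = d" and \<Phi>_cnj: "\<And>z. z \<notin> K \<Longrightarrow> cnj (\<Phi> (cnj z)) = \<Phi> z"
proof -
  define \<rho> where "\<rho> = norm d"
  have \<rho>: "\<rho> > 0" using d_nz by (simp add: \<rho>_def)
  define \<delta> where "\<delta> = d / of_real \<rho>"
  have d\<delta>: "d = \<delta> * of_real \<rho>" using \<rho> by (simp add: \<delta>_def)
  have \<delta>_nz: "\<delta> \<noteq> 0" using d_nz \<rho> by (simp add: \<delta>_def)
  have \<delta>n: "cnj (\<delta> ^ n) = \<delta> ^ n" using cnj_d_power by (simp add: \<delta>_def power_divide)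
  \<comment> \<open>In the coordinate \<open>X\<close> the centers become \<open>- b1\<close> and
    \<open>b2\<close>, so \<open>U\<close> has real coefficients.\<close>
  define b1 b2 :: real where "b1 = n2 * \<rho> / n" and "b2 = n1 * \<rho> / n"
  define U where "U = [:complex_of_real b1, 1:] ^ n1 * [:- complex_of_real b2, 1:] ^ n2"
  define X where "X z = (\<Phi> z - t) / \<delta>" for z
  define Y where "Y z = cnj (X (cnj z))" for z
  have Xb: "X z + of_real b1 = (\<Phi> z - a1) / \<delta>" "X z - of_real b2 = (\<Phi> z - a2) / \<delta>" for z
  proof -
    have "of_real b1 = of_nat n2 / of_nat n * d / \<delta>" "of_real b2 = of_nat n1 / of_nat n * d / \<delta>"
      using \<delta>_nz by (simp_all add: b1_def b2_def d\<delta>)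
    then show "X z + of_real b1 = (\<Phi> z - a1) / \<delta>" "X z - of_real b2 = (\<Phi> z - a2) / \<delta>"
      unfolding X_def by (subst centers, simp add: add_divide_distrib diff_divide_distrib)+
  qed
  have polyU: "poly U w = (w + of_real b1) ^ n1 * (w - of_real b2) ^ n2" for w
    by (simp add: U_def poly_power add.commute)
  have UX: "poly U (X z) = f z / (2 * lead_coeff P) / \<delta> ^ n" if "z \<notin> K" for z
    unfolding polyU Xb product_formula[OF that, symmetric] by (simp add: power_divide n_sum power_add)
  have UY: "poly U (Y z) = f z / (2 * lead_coeff P) / \<delta> ^ n" if z: "z \<notin> K" for z
  proof -
    have "poly U (Y z) = cnj (poly U (X (cnj z)))" by (simp add: polyU Y_def)
    also have "\<dots> = cnj (f (cnj z) / (2 * lead_coeff P)) / cnj (\<delta> ^ n)"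
      using UX[of "cnj z"] z K_cnj by simp
    finally show ?thesis unfolding \<delta>n f_ratio_cnj[OF z] .
  qed
  have holX: "X holomorphic_on - K" unfolding X_def using \<delta>_nz \<Phi>_holo by (intro holomorphic_intros) auto
  have "cnj ` (- K) = - K" by (auto simp: set_eq_iff in_image_cnj_iff K_cnj)
  then have holY: "Y holomorphic_on - K"
    using holomorphic_on_compose_cnj_cnj[of X "- K"] holX openD by (simp add: Y_def[abs_def] o_def)
  \<comment> \<open>This is the critical point of \<open>U\<close> between its two zeros, and the
    value of \<open>X\<close> at \<open>z1\<close>.\<close>
  define x where "x = (real n1 - real n2) * \<rho> / n"
  have xb: "complex_of_real x + of_real b1 = of_real (n1 * \<rho> / n)" "complex_of_real x - of_real b2 = - of_real (n2 * \<rho> / n)"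
    by (simp_all add: x_def b1_def b2_def flip: of_real_add of_real_diff of_real_minus)
       (simp_all add: field_simps)
  have Xz1: "X z1 = of_real x"
  proof -
    have "X z1 + of_real b1 = of_real (n1 * \<rho> / n)" unfolding Xb \<Phi>_z1 using \<delta>_nz by (simp add: d\<delta>)
    then show ?thesis using xb(1) by (metis add_right_cancel)
  qed
  have dX: "deriv X z1 = deriv \<Phi> z1 / \<delta>"
    unfolding X_def using DERIV_cdivide[OF DERIV_diff[OF deriv_\<Phi>[OF z1(1)] DERIV_const[of t]], of \<delta>]
    by (simp add: DERIV_imp_deriv)
  have dY: "deriv Y z1 = cnj (deriv X z1)"
  proof -
    have "(X has_field_derivative deriv X z1) (at (cnj z1))"
      using holomorphic_derivI[OF holX openD] z1 z1_real by simp
    from has_field_derivative_cnj_cnj[OF this] show ?thesis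
      by (simp add: Y_def[abs_def] o_def DERIV_imp_deriv)
  qed
  \<comment> \<open>In \<open>\<Phi>'_square\<close> the minus sign from the opposite positions of
    the centers cancels the one from \<open>second_deriv_ratio\<close>, so the square of the
    derivative is a nonnegative real.\<close>
  have "Im (deriv X z1) = 0"
  proof -
    obtain r where r: "r \<ge> 0" "deriv (deriv f) z1 / f z1 = - complex_of_real r" using second_deriv_ratio by blast
    have "(deriv X z1)^2 = of_real (r * (n1 * n2 * \<rho>^2 / n^3))"
    proof -
      have "- complex_of_real r = of_nat n * (deriv \<Phi> z1)^2 / ((of_nat n1 / of_nat n * d) * (- (of_nat n2 / of_nat n * d)))"
        using \<Phi>'_square unfolding r \<Phi>_z1 .
      also have "(of_nat n1 / of_nat n * d) * (- (of_nat n2 / of_nat n * d)) = - (of_nat n1 * of_nat n2 * (of_real \<rho>)^2 / (of_nat n)^2 * \<delta>^2)"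
        by (simp add: d\<delta> power2_eq_square field_simps)
      also have "of_nat n * (deriv \<Phi> z1)^2 / - (of_nat n1 * of_nat n2 * (of_real \<rho>)^2 / (of_nat n)^2 * \<delta>^2)
          = - ((deriv X z1)^2 / (of_nat n1 * of_nat n2 * (of_real \<rho>)^2 / (of_nat n)^3))"
        using \<delta>_nz \<rho> n12_pos by (simp add: dX power_divide field_simps power2_eq_square power3_eq_cube)
      finally have "complex_of_real r = (deriv X z1)^2 / (of_nat n1 * of_nat n2 * (of_real \<rho>)^2 / (of_nat n)^3)" by simp
      then show ?thesis using \<rho> n12_pos by (simp add: field_simps)
    qed
    then show ?thesis by (rule real_of_square_nonneg) (use r in simp)
  qed
  then have jet: "deriv X z1 = deriv Y z1" unfolding dY by (simp add: complex_eq_iff)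
  have XY: "X z = Y z" if "z \<in> - K" for z
  proof (rule holomorphic_eq_if_poly_eq_at_critical_point[OF openD connD _ holX holY, of z1 U])
    show "X z1 = Y z1" by (simp add: Y_def z1_real Xz1)
    show "deriv X z1 \<noteq> 0" using deriv_\<Phi>_nz[OF z1(1)] \<delta>_nz by (simp add: dX)
    have c1: "complex_of_real x + of_real b1 \<noteq> 0" "complex_of_real x - of_real b2 \<noteq> 0"
      unfolding xb using n12_pos \<rho> degP by auto
    have c2: "of_nat n1 * (complex_of_real x - of_real b2) + of_nat n2 * (complex_of_real x + of_real b1) = 0"
      unfolding xb by simp
    show "poly (pderiv U) (X z1) = 0" "poly (pderiv (pderiv U)) (X z1) \<noteq> 0"
      unfolding U_def Xz1 using two_factor_poly_critical_point[OF c1 c2] n12_pos by simp_all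
  qed (use UX UY jet z1 that in auto)
  \<comment> \<open>At infinity \<open>X\<close> behaves like \<open>z / \<delta>\<close> and its
    reflection like \<open>z / cnj \<delta>\<close>, so their equality makes \<open>\<delta>\<close>
    real.\<close>
  have LX: "((\<lambda>z. X z / z) \<longlongrightarrow> 1 / \<delta>) at_infinity"
  proof -
    have "((\<lambda>z. (\<Phi> z - t) / z / \<delta>) \<longlongrightarrow> 1 / \<delta>) at_infinity"
      using \<delta>_nz by (intro tendsto_intros \<Phi>_minus_over_z)
    then show ?thesis by (simp add: X_def mult.commute)
  qed
  have "filterlim cnj at_infinity at_infinity"
    by (simp add: filterlim_at_infinity[OF order_refl] eventually_at_infinity) blast
  from filterlim_compose[OF LX this] have "((\<lambda>z. cnj (X (cnj z) / cnj z)) \<longlongrightarrow> cnj (1 / \<delta>)) at_infinity"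
    by (intro tendsto_cnj)
  then have LY: "((\<lambda>z. Y z / z) \<longlongrightarrow> cnj (1 / \<delta>)) at_infinity" by (simp add: Y_def)
  have "eventually (\<lambda>z. Y z / z = X z / z) at_infinity"
    using eventually_notin_K by eventually_elim (simp add: XY)
  then have "((\<lambda>z. X z / z) \<longlongrightarrow> cnj (1 / \<delta>)) at_infinity" by (rule Lim_transform_eventually[OF LY])
  from tendsto_unique[OF trivial_limit_at_infinity LX this] have \<delta>_real: "cnj \<delta> = \<delta>" by simp
  then show "cnj d = d" by (simp add: d\<delta>)
  fix z assume "z \<notin> K"
  then have "(cnj (\<Phi> (cnj z)) - t) / \<delta> = (\<Phi> z - t) / \<delta>"
    using XY[of z] by (auto simp: X_def Y_def \<delta>_real t_cnj)
  then show "cnj (\<Phi> (cnj z)) = \<Phi> z" using \<delta>_nz by auto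
qed

end

section \<open>Order of the centers\<close>

context symmetric_lemniscatic_pair
begin

lemma d_eq [simp]: "complex_of_real (Re d) = d" using d_real by (simp add: complex_eq_iff)

lemma centers_real: "cnj a1 = a1" "cnj a2 = a2"
proof -
  show "cnj a1 = a1" by (subst (1 2) centers(1)) (simp add: t_cnj d_real)
  show "cnj a2 = a2" by (subst (1 2) centers(2)) (simp add: t_cnj d_real)
qed

lemma \<Phi>_cnj': "z \<notin> K \<Longrightarrow> \<Phi> (cnj z) = cnj (\<Phi> z)"
  using \<Phi>_cnj[of z] by (metis complex_cnj_cnj)

text \<open>The difference quotient \<open>(\<Phi> z - \<Phi> (cnj z)) / (z - cnj z)\<close>, extended by \<open>\<Phi>'\<close> to the real axis, is real,
  continuous, and vanishes nowhere because \<open>\<Phi>\<close> is injective.\<close>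

lemma Im_\<Phi>_sign:
  assumes z: "z \<notin> K" and im: "Im z \<noteq> 0"
  shows "Im (\<Phi> z) / Im z > 0"
proof -
  define \<kappa> where "\<kappa> z = (if Im z = 0 then Re (deriv \<Phi> z) else Im (\<Phi> z) / Im z)" for z
  have nz: "\<kappa> z \<noteq> 0" if z: "z \<in> - K" for z
  proof (cases "Im z = 0")
    case True
    then have cz: "cnj z = z" by (simp add: complex_eq_iff)
    have "deriv \<Phi> (cnj z) = 1 * cnj (deriv \<Phi> z)"
      by (rule deriv_cnj_symmetric[OF openD \<Phi>_holo D_cnj _ _ z]) (auto simp: \<Phi>_cnj')
    then have "deriv \<Phi> z = cnj (deriv \<Phi> z)" unfolding cz by simp
    then have "Im (deriv \<Phi> z) = 0" by (simp add: complex_eq_iff)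
    then show ?thesis using True deriv_\<Phi>_nz[of z] z by (auto simp: \<kappa>_def complex_eq_iff)
  next
    case False
    have "Im (\<Phi> z) \<noteq> 0"
    proof
      assume "Im (\<Phi> z) = 0"
      then have "\<Phi> (cnj z) = \<Phi> z" using \<Phi>_cnj'[of z] z by (simp add: complex_eq_iff)
      then have "cnj z = z" using \<Phi>_inj D_cnj[OF z] z by (auto simp: inj_on_def)
      then show False using False by (simp add: complex_eq_iff)
    qed
    then show ?thesis using False by (simp add: \<kappa>_def)
  qed
  have "continuous_on (- K) \<kappa>"
  proof (subst continuous_on_eq_continuous_at[OF openD], intro ballI)
    fix z0 assume z0: "z0 \<in> - K"
    show "isCont \<kappa> z0"
    proof (cases "Im z0 = 0")
      case False
      have "isCont \<Phi> z0" using deriv_\<Phi>[of z0] z0 DERIV_isCont by auto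
      then have "isCont (\<lambda>z. Im (\<Phi> z) / Im z) z0" using False by (intro continuous_intros) auto
      moreover have "eventually (\<lambda>z. \<kappa> z = Im (\<Phi> z) / Im z) (nhds z0)"
      proof -
        have "open {z. Im z \<noteq> 0}" by (intro open_Collect_neq continuous_intros)
        then have "eventually (\<lambda>z. z \<in> {z. Im z \<noteq> 0}) (nhds z0)" using False by (intro eventually_nhds_in_open) auto
        then show ?thesis by eventually_elim (simp add: \<kappa>_def)
      qed
      ultimately show ?thesis by (simp add: isCont_cong)
    next
      case True
      have z0r: "cnj z0 = z0" using True by (simp add: complex_eq_iff)
      show ?thesis unfolding continuous_at_eps_delta
      proof (intro allI impI)
        fix \<epsilon> :: real assume \<epsilon>: "\<epsilon> > 0"
        have "continuous_on (- K) (deriv \<Phi>)"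
          by (intro holomorphic_on_imp_continuous_on holomorphic_deriv \<Phi>_holo openD)
        then have "isCont (deriv \<Phi>) z0" using z0 openD by (simp add: continuous_on_eq_continuous_at)
        then obtain \<delta>1 where \<delta>1: "\<delta>1 > 0" "\<And>w. dist w z0 < \<delta>1 \<Longrightarrow> dist (deriv \<Phi> w) (deriv \<Phi> z0) < \<epsilon> / 2"
          unfolding continuous_at_eps_delta using \<epsilon> by (metis half_gt_zero)
        obtain \<delta>2 where \<delta>2: "\<delta>2 > 0" "ball z0 \<delta>2 \<subseteq> - K" using openE[OF openD z0] by metis
        define r where "r = min \<delta>1 \<delta>2"
        have r: "r > 0" "\<And>w. w \<in> ball z0 r \<Longrightarrow> w \<notin> K" "\<And>w. w \<in> ball z0 r \<Longrightarrow> norm (deriv \<Phi> w - deriv \<Phi> z0) \<le> \<epsilon> / 2"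
          using \<delta>1 \<delta>2 by (auto simp: r_def dist_norm norm_minus_commute subset_iff intro: less_imp_le)
        have "dist (\<kappa> w) (\<kappa> z0) < \<epsilon>" if w: "dist w z0 < r" for w
        proof (cases "Im w = 0")
          case w0: True
          have "\<kappa> w - \<kappa> z0 = Re (deriv \<Phi> w - deriv \<Phi> z0)" using w0 True by (simp add: \<kappa>_def)
          then have "\<bar>\<kappa> w - \<kappa> z0\<bar> \<le> norm (deriv \<Phi> w - deriv \<Phi> z0)" by (metis abs_Re_le_cmod)
          also have "\<dots> \<le> \<epsilon> / 2" using r(3)[of w] w by (simp add: dist_commute)
          finally show ?thesis using \<epsilon> by (simp add: dist_real_def)
        next
          case w0: False
          have win: "w \<in> ball z0 r" using w by (simp add: dist_commute)
          have cwin: "cnj w \<in> ball z0 r"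
          proof -
            have "dist z0 (cnj w) = norm (cnj (z0 - w))" by (simp add: dist_norm z0r)
            then show ?thesis using w by (simp add: dist_norm norm_minus_commute del: complex_cnj_diff)
          qed
          \<comment> \<open>The mean value inequality between \<open>w\<close> and
            \<open>cnj w\<close> compares the difference quotient with the derivative at the real
            point \<open>z0\<close>.\<close>
          have "norm ((\<Phi> w - deriv \<Phi> z0 * w) - (\<Phi> (cnj w) - deriv \<Phi> z0 * cnj w)) \<le> \<epsilon> / 2 * norm (w - cnj w)"
          proof (rule field_differentiable_bound[OF convex_ball _ _ win cwin])
            fix x assume x: "x \<in> ball z0 r"
            show "((\<lambda>w. \<Phi> w - deriv \<Phi> z0 * w) has_field_derivative (deriv \<Phi> x - deriv \<Phi> z0 * 1)) (at x within ball z0 r)"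
              by (intro has_field_derivative_at_within[OF DERIV_diff] DERIV_cmult DERIV_ident deriv_\<Phi> r(2) x)
            show "norm (deriv \<Phi> x - deriv \<Phi> z0 * 1) \<le> \<epsilon> / 2" using r(3)[OF x] by simp
          qed
          also have "(\<Phi> w - deriv \<Phi> z0 * w) - (\<Phi> (cnj w) - deriv \<Phi> z0 * cnj w) = (w - cnj w) * (of_real (Im (\<Phi> w) / Im w) - deriv \<Phi> z0)"
          proof -
            have "\<Phi> w - \<Phi> (cnj w) = (w - cnj w) * of_real (Im (\<Phi> w) / Im w)"
              using w0 \<Phi>_cnj'[OF r(2)[OF win]] by (simp add: complex_diff_cnj)
            then show ?thesis by (simp add: algebra_simps)
          qed
          finally have "norm (of_real (Im (\<Phi> w) / Im w) - deriv \<Phi> z0) \<le> \<epsilon> / 2"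
            using w0 by (simp add: norm_mult complex_diff_cnj)
          moreover have "\<kappa> w - \<kappa> z0 = Re (of_real (Im (\<Phi> w) / Im w) - deriv \<Phi> z0)"
            using w0 True by (simp add: \<kappa>_def)
          then have "\<bar>\<kappa> w - \<kappa> z0\<bar> \<le> norm (of_real (Im (\<Phi> w) / Im w) - deriv \<Phi> z0)" by (metis abs_Re_le_cmod)
          ultimately show ?thesis using \<epsilon> by (simp add: dist_real_def)
        qed
        then show "\<exists>d>0. \<forall>x. dist x z0 < d \<longrightarrow> dist (\<kappa> x) (\<kappa> z0) < \<epsilon>" using r(1) by blast
      qed
    qed
  qed
  then have conn: "connected (\<kappa> ` (- K))" using connD by (rule connected_continuous_image)
  have "eventually (\<lambda>z. norm (\<Phi> z - z) < 1 \<and> z \<notin> K) at_infinity"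
    using tendstoD[OF \<Phi>_tendsto, of 1] eventually_notin_K by (auto simp: eventually_conj_iff)
  then obtain b where b: "\<And>z. norm z \<ge> b \<Longrightarrow> norm (\<Phi> z - z) < 1 \<and> z \<notin> K"
    by (auto simp: eventually_at_infinity)
  \<comment> \<open>High on the imaginary axis \<open>\<Phi>\<close> moves points by less than 1, so
    \<open>\<kappa>\<close> is positive there, and by connectedness everywhere.\<close>
  define y where "y = \<i> * of_real (max b 1)"
  have y: "norm (\<Phi> y - y) < 1" "y \<notin> K" "Im y \<ge> 1" using b[of y] by (auto simp: y_def norm_mult)
  have "\<bar>Im (\<Phi> y - y)\<bar> < 1" using abs_Im_le_cmod[of "\<Phi> y - y"] y(1) by linarith
  then have "Im (\<Phi> y) > 0" using y(3) by (simp add: abs_less_iff)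
  then have "\<kappa> y > 0" using y(3) by (simp add: \<kappa>_def)
  have "\<kappa> z > 0"
  proof (rule ccontr)
    assume "\<not> \<kappa> z > 0"
    then have "0 \<in> \<kappa> ` (- K)"
      using connectedD_interval[OF conn, of "\<kappa> z" "\<kappa> y" 0] \<open>\<kappa> y > 0\<close> z y by auto
    then show False using nz by auto
  qed
  then show ?thesis using im by (simp add: \<kappa>_def)
qed

lemma a1_eq: "a1 = complex_of_real (Re a1)" using centers_real(1) by (simp add: complex_eq_iff)

lemma \<Phi>_of_real: "complex_of_real x \<notin> K \<Longrightarrow> \<Phi> (complex_of_real x) = complex_of_real (Re (\<Phi> (complex_of_real x)))"
  using \<Phi>_cnj'[of "complex_of_real x"] by (simp add: complex_eq_iff)

text \<open>On the real axis \<open>\<Phi>\<close> is real and never equals \<open>a1\<close>, so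
  the intermediate value theorem applies on intervals free of \<open>K\<close>.\<close>

lemma \<Phi>_same_side:
  assumes free: "\<And>w. min x y \<le> w \<Longrightarrow> w \<le> max x y \<Longrightarrow> complex_of_real w \<notin> K"
    and pos: "Re (\<Phi> (complex_of_real x)) - Re a1 > 0"
  shows "Re (\<Phi> (complex_of_real y)) - Re a1 > 0"
proof (rule ccontr)
  assume neg: "\<not> Re (\<Phi> (complex_of_real y)) - Re a1 > 0"
  let ?g = "\<lambda>w. Re (\<Phi> (complex_of_real w)) - Re a1"
  have "continuous_on {min x y..max x y} ?g"
    using free by (intro continuous_intros continuous_on_compose2[OF holomorphic_on_imp_continuous_on[OF \<Phi>_holo]]) auto
  then have "connected (?g ` {min x y..max x y})" by (rule connected_continuous_image) simp
  then have "0 \<in> ?g ` {min x y..max x y}"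
    using connectedD_interval[of "?g ` {min x y..max x y}" "?g y" "?g x" 0] pos neg by auto
  then obtain w where w: "w \<in> {min x y..max x y}" "?g w = 0" by auto
  then have wK: "complex_of_real w \<notin> K" using free by auto
  then have "\<Phi> (complex_of_real w) = a1" using \<Phi>_of_real[OF wK] a1_eq w by (metis right_minus_eq)
  then show False using \<Phi>_ne(1)[OF wK] by simp
qed

text \<open>If \<open>d\<close> were negative, then \<open>\<Phi> z - a1\<close> would change sign at \<open>e2\<close> instead of \<open>e1\<close> along the real axis, and
  \<open>(\<Phi> z - a1) / (z - e2)\<close> would avoid the negative real axis.\<close>

lemma d_pos:
  assumes \<gamma>: "path \<gamma>" "pathfinish \<gamma> = pathstart \<gamma>" "path_image \<gamma> \<subseteq> - K"
    and w: "winding_number \<gamma> (complex_of_real e2) = 0" "winding_number (\<Phi> \<circ> \<gamma>) a1 \<noteq> 0"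
  shows "Re d > 0"
proof (rule ccontr)
  assume "\<not> Re d > 0"
  moreover have "Re d \<noteq> 0" using d_nz d_eq by (metis of_real_0)
  ultimately have neg: "Re d < 0" by simp
  have "eventually (\<lambda>z. norm (\<Phi> z - z) < 1 \<and> z \<notin> K) at_infinity"
    using tendstoD[OF \<Phi>_tendsto, of 1] eventually_notin_K by (auto simp: eventually_conj_iff)
  then obtain b where b: "\<And>z. norm z \<ge> b \<Longrightarrow> norm (\<Phi> z - z) < 1 \<and> z \<notin> K"
    by (auto simp: eventually_at_infinity)
  \<comment> \<open>Beyond \<open>B\<close> the map moves real points by less than 1, which cannot
    carry them across \<open>Re a1\<close>.\<close>
  define B where "B = \<bar>b\<bar> + \<bar>Re a1\<bar> + 2"
  have far: "\<bar>Re (\<Phi> (complex_of_real x)) - x\<bar> < 1" if "\<bar>x\<bar> \<ge> B" for x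
  proof -
    have "norm (\<Phi> (complex_of_real x) - complex_of_real x) < 1" using b[of "complex_of_real x"] that by (simp add: B_def)
    then show ?thesis using abs_Re_le_cmod[of "\<Phi> (complex_of_real x) - complex_of_real x"] by simp
  qed
  have z1neg: "Re (\<Phi> z1) - Re a1 < 0"
  proof -
    have "\<Phi> z1 - a1 = complex_of_real (n1 / n * Re d)" unfolding \<Phi>_z1 by simp
    then have "Re (\<Phi> z1 - a1) = n1 / n * Re d" by (metis Re_complex_of_real)
    moreover have "n1 / n * Re d < 0" by (intro mult_pos_neg) (use neg n12_pos in simp_all)
    ultimately show ?thesis by simp
  qed
  \<comment> \<open>A real point off \<open>K\<close> is connected, without meeting
    \<open>K\<close>, to a far point on the right if it exceeds \<open>e2\<close>. Otherwise it is
    so connected to \<open>x1\<close> or to a far point on the left, where the sign is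
    negative.\<close>
  have pos: "(Re (\<Phi> (complex_of_real x)) - Re a1) * (x - e2) > 0" if xK: "complex_of_real x \<notin> K" for x
  proof (cases "x > e2")
    case True
    have free: "complex_of_real w \<notin> K" if "w \<ge> x" for w
    proof
      assume wK: "complex_of_real w \<in> K"
      then have "x < w" using that xK by (cases "x = w") auto
      obtain u v where "e2 \<le> u" "u < x1"
        using gap_around[OF xK e(2) wK True \<open>x < w\<close>] by metis
      then show False using x1_between by simp
    qed
    have "Re (\<Phi> (complex_of_real (max x B))) - Re a1 > 0"
    proof -
      have "B \<le> max x B" by simp
      moreover from this have "\<bar>Re (\<Phi> (complex_of_real (max x B))) - max x B\<bar> < 1" by (intro far) linarith
      ultimately show ?thesis unfolding B_def by linarith
    qed
    then have "Re (\<Phi> (complex_of_real x)) - Re a1 > 0"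
      by (rule \<Phi>_same_side[rotated]) (use free in auto)
    then show ?thesis using True by simp
  next
    case False
    moreover have "x \<noteq> e2" using xK e by auto
    ultimately have lt: "x < e2" by simp
    have "\<not> Re (\<Phi> (complex_of_real x)) - Re a1 > 0"
    proof
      assume p: "Re (\<Phi> (complex_of_real x)) - Re a1 > 0"
      show False
      proof (cases "\<exists>u0<x. complex_of_real u0 \<in> K")
        case True
        then obtain u0 where u0: "u0 < x" "complex_of_real u0 \<in> K" by blast
        obtain u v where uv: "u < x" "x < v" "u < x1" "x1 < v" "\<And>y. u < y \<Longrightarrow> y < v \<Longrightarrow> complex_of_real y \<notin> K"
          using gap_around[OF xK u0(2) e(2) u0(1) lt] by metis
        have "Re (\<Phi> (complex_of_real x1)) - Re a1 > 0"
          by (rule \<Phi>_same_side[OF _ p]) (use uv in \<open>auto simp: min_def max_def split: if_splits\<close>)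
        then show False using z1neg by simp
      next
        case False
        have free: "complex_of_real w \<notin> K" if "w \<le> x" for w
          using False that xK by (cases "w = x") auto
        have "Re (\<Phi> (complex_of_real (min x (- B)))) - Re a1 > 0"
          by (rule \<Phi>_same_side[OF _ p]) (use free in auto)
        moreover have "min x (- B) \<le> - B" by simp
        moreover from this have "\<bar>Re (\<Phi> (complex_of_real (min x (- B)))) - min x (- B)\<bar> < 1" by (intro far) linarith
        ultimately show False unfolding B_def by linarith
      qed
    qed
    moreover have "Re (\<Phi> (complex_of_real x)) - Re a1 \<noteq> 0"
    proof
      assume "Re (\<Phi> (complex_of_real x)) - Re a1 = 0"
      then have "\<Phi> (complex_of_real x) = a1" using \<Phi>_of_real[OF xK] a1_eq by (metis right_minus_eq)
      then show False using \<Phi>_ne(1)[OF xK] by simp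
    qed
    ultimately show ?thesis using lt by (simp add: mult_neg_neg)
  qed
  \<comment> \<open>On the real axis \<open>pos\<close> makes this quotient positive; off it, a
    nonpositive value would contradict \<open>Im_\<Phi>_sign\<close>. So \<open>\<Phi> - a1\<close>
    winds along \<open>\<gamma>\<close> like \<open>z - e2\<close>, that is, not at all.\<close>
  let ?R = "\<lambda>z. (\<Phi> z - a1) / (z - complex_of_real e2)"
  have R: "?R z \<notin> \<real>\<^sub>\<le>\<^sub>0" if z: "z \<in> - K" for z
  proof
    assume "?R z \<in> \<real>\<^sub>\<le>\<^sub>0"
    then obtain l where l: "?R z = complex_of_real l" "l \<le> 0" by (auto elim!: nonpos_Reals_cases)
    have "z - complex_of_real e2 \<noteq> 0" using z e by auto
    then have eq: "\<Phi> z - a1 = complex_of_real l * (z - complex_of_real e2)" using l by (simp add: field_simps)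
    show False
    proof (cases "Im z = 0")
      case True
      then have zr: "z = complex_of_real (Re z)" by (simp add: complex_eq_iff)
      have "Re (\<Phi> z) - Re a1 = l * (Re z - e2)" using arg_cong[OF eq, of Re] True by simp
      then have "(Re (\<Phi> z) - Re a1) * (Re z - e2) = l * (Re z - e2)^2" by (simp add: power2_eq_square)
      also have "\<dots> \<le> 0" using l by (simp add: mult_nonpos_nonneg)
      finally show False using pos[of "Re z"] z zr by (metis ComplD not_le)
    next
      case False
      have "Im a1 = 0" using a1_eq by (metis Im_complex_of_real)
      then have "Im (\<Phi> z) = l * Im z" using arg_cong[OF eq, of Im] by simp
      then have "Im (\<Phi> z) / Im z = l" using False by simp
      then show False using Im_\<Phi>_sign[of z] False z l by simp
    qed
  qed
  have c\<Phi>: "continuous_on (path_image \<gamma>) \<Phi>"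
    using holomorphic_on_imp_continuous_on[OF \<Phi>_holo] \<gamma>(3) continuous_on_subset by blast
  have ne2: "z - complex_of_real e2 \<noteq> 0" if "z \<in> path_image \<gamma>" for z using that \<gamma>(3) e(2) by auto
  have cR: "continuous_on (path_image \<gamma>) ?R" by (intro continuous_intros c\<Phi>) (use ne2 in auto)
  have pR: "path (?R \<circ> \<gamma>)" using path_continuous_image[OF \<gamma>(1) cR] .
  have "winding_number (?R \<circ> \<gamma>) 0 = 0"
    by (rule winding_number_zero_compl_nonpos_Reals[OF pR])
       (use \<gamma> R in \<open>auto simp: path_image_compose pathfinish_compose pathstart_compose simp del: o_apply\<close>)
  moreover have "winding_number (\<lambda>t. (\<gamma> t - complex_of_real e2) * (?R \<circ> \<gamma>) t) 0
      = winding_number (\<lambda>t. \<gamma> t - complex_of_real e2) 0 + winding_number (?R \<circ> \<gamma>) 0"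
  proof (rule winding_number_mult[OF _ pR])
    show "path (\<lambda>t. \<gamma> t - complex_of_real e2)" using \<gamma>(1) by (auto simp: path_def intro: continuous_intros)
    show "0 \<notin> path_image (\<lambda>t. \<gamma> t - complex_of_real e2)" using ne2 by (force simp: path_image_def)
    show "0 \<notin> path_image (?R \<circ> \<gamma>)" using R \<gamma>(3) unfolding path_image_compose by force
  qed (use \<gamma>(2) in \<open>auto simp: pathfinish_def pathstart_def\<close>)
  moreover have "winding_number (\<lambda>t. (\<gamma> t - complex_of_real e2) * (?R \<circ> \<gamma>) t) 0 = winding_number (\<lambda>t. (\<Phi> \<circ> \<gamma>) t - a1) 0"
  proof (rule winding_number_cong)
    fix t :: real assume "0 \<le> t" "t \<le> 1"
    then have "\<gamma> t \<in> path_image \<gamma>" by (auto simp: path_image_def)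
    from ne2[OF this] show "(\<gamma> t - complex_of_real e2) * (?R \<circ> \<gamma>) t = (\<Phi> \<circ> \<gamma>) t - a1" by simp
  qed
  ultimately have "winding_number (\<lambda>t. (\<Phi> \<circ> \<gamma>) t - a1) 0 = winding_number (\<lambda>t. \<gamma> t - complex_of_real e2) 0"
    by simp
  then have "winding_number (\<Phi> \<circ> \<gamma>) a1 = winding_number \<gamma> (complex_of_real e2)"
    unfolding winding_number_offset[of "\<Phi> \<circ> \<gamma>" a1] winding_number_offset[of \<gamma> "complex_of_real e2"] .
  then show False using w by simp
qed

text \<open>The bases are the distances of \<open>a1\<close> and \<open>a2\<close> from
  \<open>t\<close>. In \<open>d_power\<close> one of the two factors is rescaled to make both bases
  equal, and the sign \<open>(-1) ^ n2\<close> is moved to the other side.\<close>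

lemma radius_power:
  shows "complex_of_real ((n2 / n * Re d) ^ n) = (of_nat n2 / of_nat n1) ^ n1 * ((-1) ^ n2 / (2 * lead_coeff P)) * f z1"
    and "complex_of_real ((n1 / n * Re d) ^ n) = (of_nat n1 / of_nat n2) ^ n2 * ((-1) ^ n2 / (2 * lead_coeff P)) * f z1"
proof -
  have nz: "of_nat n1 \<noteq> (0::complex)" "of_nat n2 \<noteq> (0::complex)" using n12_pos by auto
  have sgn: "(-1 :: complex) ^ n2 * (-1) ^ n2 = 1" by (simp flip: power_mult_distrib)
  have "(-1) ^ n2 / (2 * lead_coeff P) * f z1 = (-1) ^ n2 * ((of_nat n1 / of_nat n * d) ^ n1 * (- (of_nat n2 / of_nat n * d)) ^ n2)"
    unfolding d_power by simp
  also have "\<dots> = ((-1) ^ n2 * (-1) ^ n2) * ((of_nat n1 / of_nat n * d) ^ n1 * (of_nat n2 / of_nat n * d) ^ n2)"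
    by (subst power_minus[of "of_nat n2 / of_nat n * d"]) (simp only: mult_ac)
  finally have f: "(-1) ^ n2 / (2 * lead_coeff P) * f z1 = (of_nat n1 / of_nat n * d) ^ n1 * (of_nat n2 / of_nat n * d) ^ n2"
    unfolding sgn by simp
  have "complex_of_real ((k / n * Re d) ^ n) = (of_nat k / of_nat n * d) ^ n1 * (of_nat k / of_nat n * d) ^ n2" for k :: nat
    by (simp add: n_sum power_add)
  moreover have "(of_nat n2 / of_nat n * d) ^ n1 = (of_nat n2 / of_nat n1) ^ n1 * (of_nat n1 / of_nat n * d) ^ n1"
    using nz by (simp flip: power_mult_distrib)
  moreover have "(of_nat n1 / of_nat n * d) ^ n2 = (of_nat n1 / of_nat n2) ^ n2 * (of_nat n2 / of_nat n * d) ^ n2"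
    using nz by (simp flip: power_mult_distrib)
  ultimately show "complex_of_real ((n2 / n * Re d) ^ n) = (of_nat n2 / of_nat n1) ^ n1 * ((-1) ^ n2 / (2 * lead_coeff P)) * f z1"
    "complex_of_real ((n1 / n * Re d) ^ n) = (of_nat n1 / of_nat n2) ^ n2 * ((-1) ^ n2 / (2 * lead_coeff P)) * f z1"
    unfolding mult.assoc f by (simp_all only: mult_ac)
qed

lemma center_formula:
  assumes "Re d > 0"
  shows "a1 \<in> \<real> \<and> a2 \<in> \<real> \<and> Re a1 < Re a2 \<and>
    (\<exists>r1 r2 :: real. r1 > 0 \<and> r2 > 0 \<and>
       complex_of_real r1 = (of_nat n2 / of_nat n1) ^ n1 * ((-1) ^ n2 / (2 * coeff P n)) * (poly P z1 + s z1) \<and>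
       complex_of_real r2 = (of_nat n1 / of_nat n2) ^ n2 * ((-1) ^ n2 / (2 * coeff P n)) * (poly P z1 + s z1) \<and>
       a1 = - coeff P (n - 1) / (of_nat n * coeff P n) - complex_of_real (root n r1) \<and>
       a2 = - coeff P (n - 1) / (of_nat n * coeff P n) + complex_of_real (root n r2))"
proof (intro conjI)
  show "a1 \<in> \<real>" "a2 \<in> \<real>" using centers_real by (auto simp: Reals_cnj_iff)
  show "Re a1 < Re a2" using assms by (simp add: d_def)
  have pos: "n2 / n * Re d > 0" "n1 / n * Re d > 0" using assms n12_pos by simp_all
  show "\<exists>r1 r2 :: real. r1 > 0 \<and> r2 > 0 \<and>
       complex_of_real r1 = (of_nat n2 / of_nat n1) ^ n1 * ((-1) ^ n2 / (2 * coeff P n)) * (poly P z1 + s z1) \<and>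
       complex_of_real r2 = (of_nat n1 / of_nat n2) ^ n2 * ((-1) ^ n2 / (2 * coeff P n)) * (poly P z1 + s z1) \<and>
       a1 = - coeff P (n - 1) / (of_nat n * coeff P n) - complex_of_real (root n r1) \<and>
       a2 = - coeff P (n - 1) / (of_nat n * coeff P n) + complex_of_real (root n r2)"
  proof (intro exI conjI)
    show "(n2 / n * Re d) ^ n > 0" "(n1 / n * Re d) ^ n > 0" by (rule zero_less_power[OF pos(1)], rule zero_less_power[OF pos(2)])
    have rt: "root n ((n2 / n * Re d) ^ n) = n2 / n * Re d" "root n ((n1 / n * Re d) ^ n) = n1 / n * Re d"
      using pos degP0 by (intro real_root_power_cancel; simp)+
    show "a1 = - coeff P (n - 1) / (of_nat n * coeff P n) - complex_of_real (root n ((n2 / n * Re d) ^ n))"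
      unfolding rt t_def[symmetric] by (subst centers(1)) simp
    show "a2 = - coeff P (n - 1) / (of_nat n * coeff P n) + complex_of_real (root n ((n1 / n * Re d) ^ n))"
      unfolding rt t_def[symmetric] by (subst centers(2)) simp
  qed (use radius_power in \<open>simp_all only: f_def\<close>)
qed

end

section \<open>Reduction of the theorem to the symmetric situation\<close>

lemma connected_cnj_symmetric_meets_reals:
  assumes "connected C" "cnj ` C = C" "C \<noteq> {}"
  obtains x where "complex_of_real x \<in> C"
proof -
  obtain z where z: "z \<in> C" using assms by blast
  then have cz: "cnj z \<in> C" using assms by blast
  have conn: "connected (Im ` C)" by (intro connected_continuous_image continuous_intros assms)
  have im: "Im z \<in> Im ` C" "Im (cnj z) \<in> Im ` C" using z cz by blast+
  have "0 \<in> Im ` C"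
  proof (cases "Im z \<ge> 0")
    case True
    show ?thesis by (rule connectedD_interval[OF conn im(2,1)]) (use True in simp_all)
  next
    case False
    show ?thesis by (rule connectedD_interval[OF conn im]) (use False in simp_all)
  qed
  then obtain w where "w \<in> C" "Im w = 0" by auto
  then have "complex_of_real (Re w) = w" by (simp add: complex_eq_iff)
  then show ?thesis using that[of "Re w"] \<open>w \<in> C\<close> by simp
qed

lemma sum_mset_indicator:
  "(\<Sum>x\<in>#A. if Q x then w else 0) = (w :: complex) * of_nat (size {#x \<in># A. Q x#})"
  by (induction A) (simp_all add: algebra_simps)

text \<open>All zeros of \<open>P\<close> lie in its interval preimage, hence inside the curve or
  outside it. The sign \<open>\<epsilon>\<close> is the orientation of \<open>\<gamma>\<close>,
  which \<open>surrounds\<close> leaves open.\<close>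

lemma winding_number_proots_surrounds:
  assumes "P \<noteq> 0" "surrounds \<gamma> A (interval_preimage P)"
  obtains \<epsilon> where "\<epsilon> \<in> {1, -1}" "(\<Sum>x\<in>#proots P. winding_number \<gamma> x) = \<epsilon> * of_nat (num_zeros_in P A)"
proof -
  from assms(2) have \<gamma>: "simple_path \<gamma>" "pathfinish \<gamma> = pathstart \<gamma>" "A \<subseteq> inside (path_image \<gamma>)"
    "interval_preimage P - A \<subseteq> outside (path_image \<gamma>)" by (auto simp: surrounds_def)
  obtain \<epsilon> :: complex where \<epsilon>: "\<epsilon> \<in> {1, -1}" "\<And>z. z \<in> inside (path_image \<gamma>) \<Longrightarrow> winding_number \<gamma> z = \<epsilon>"
    by (rule simple_closed_path_winding_number_inside[OF \<gamma>(1)]) auto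
  have "winding_number \<gamma> x = (if x \<in> A then \<epsilon> else 0)" if "x \<in># proots P" for x
  proof -
    have "poly P x = 0" using that assms(1) by auto
    then have "x \<in> interval_preimage P" by (force simp: interval_preimage_def image_iff intro: bexI[of _ 0])
    then show ?thesis
      using \<gamma> \<epsilon>(2) winding_number_zero_in_outside[OF simple_path_imp_path[OF \<gamma>(1)] \<gamma>(2)] by auto
  qed
  then have "(\<Sum>x\<in>#proots P. winding_number \<gamma> x) = (\<Sum>x\<in>#proots P. if x \<in> A then \<epsilon> else 0)"
    by (intro arg_cong[where f = sum_mset] image_mset_cong) auto
  also have "\<dots> = \<epsilon> * of_nat (num_zeros_in P A)" by (simp add: sum_mset_indicator num_zeros_in_def)
  finally show ?thesis using that \<epsilon>(1) by blast
qed

theorem theorem3p1: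
  fixes P :: "complex poly" and n n1 n2 :: nat
    and E :: "nat \<Rightarrow> complex set" and z1 :: complex and s :: "complex \<Rightarrow> complex"
    and a :: "nat \<Rightarrow> complex" and m :: "nat \<Rightarrow> real" and \<Phi> :: "complex \<Rightarrow> complex"
  defines "n \<equiv> degree P"
    and "n1 \<equiv> num_zeros_in P (E 1)"
    and "n2 \<equiv> num_zeros_in P (E 2)"
  assumes "n \<ge> 1"
    and "(\<forall>j. coeff P j \<in> \<real>) \<or> (\<forall>j. Re (coeff P j) = 0)"
    and "components (interval_preimage P) = {E 1, E 2}" and "E 1 \<noteq> E 2"
    and "cnj ` E 1 = E 1" and "cnj ` E 2 = E 2"
    and "\<And>x y :: real. complex_of_real x \<in> E 1 \<Longrightarrow> complex_of_real y \<in> E 2 \<Longrightarrow> x < y"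
    and "z1 \<notin> interval_preimage P" and "poly (pderiv P) z1 = 0"
    and "is_sqrt_branch P s"
    and "walsh_map 2 E a m \<Phi>"
  shows "a 1 \<in> \<real> \<and> a 2 \<in> \<real> \<and> Re (a 1) < Re (a 2) \<and>
    (\<exists>r1 r2 :: real. r1 > 0 \<and> r2 > 0 \<and>
       complex_of_real r1 = (of_nat n2 / of_nat n1) ^ n1 * ((-1) ^ n2 / (2 * coeff P n))
                              * (poly P z1 + s z1) \<and>
       complex_of_real r2 = (of_nat n1 / of_nat n2) ^ n2 * ((-1) ^ n2 / (2 * coeff P n))
                              * (poly P z1 + s z1) \<and>
       a 1 = - coeff P (n - 1) / (of_nat n * coeff P n) - complex_of_real (root n r1) \<and>
       a 2 = - coeff P (n - 1) / (of_nat n * coeff P n) + complex_of_real (root n r2))"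
proof -
  define K where "K = interval_preimage P"
  define c where "c = log_capacity K"
  have KE: "K = E 1 \<union> E 2" using Union_components[of K] assms(6) by (simp add: K_def)
  have set2: "{1..2} = {1, 2::nat}" by auto
  have KU: "(\<Union>j\<in>{1..2}. E j) = K" unfolding KE set2 by simp
  define L where "L = {w. norm (w - a 1) powr m 1 * norm (w - a 2) powr m 2 \<le> c}"
  have L: "lemniscatic_set 2 a m c = L" unfolding lemniscatic_set_def L_def set2 by simp
  note W = assms(14)[unfolded walsh_map_def Let_def KU c_def[symmetric] L]
  have W1: "inj_on a {1..2}" "\<forall>j\<in>{1..2}. m j > 0" "(\<Sum>j\<in>{1..2}. m j) = 1"
    "\<Phi> holomorphic_on (- K)" "bij_betw \<Phi> (- K) (- L)" "(\<lambda>z. \<Phi> z - z) \<in> O[at_infinity](\<lambda>z. 1 / z)"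
    "bij_betw (\<lambda>j. connected_component_set L (a j)) {1..2} (components L)"
    "\<forall>j\<in>{1..2}. \<exists>\<gamma>. surrounds \<gamma> (E j) K \<and> surrounds (\<Phi> \<circ> \<gamma>) (connected_component_set L (a j)) L"
    using W by blast+
  have c0: "c \<ge> 0" by (simp add: c_def log_capacity_def Let_def)
  have ane: "a 1 \<noteq> a 2" using W1(1) unfolding set2 by (auto simp: inj_on_def)
  have mpos: "m 1 > 0" "m 2 > 0" and msum: "m 1 + m 2 = 1" using W1(2,3) unfolding set2 by auto
  interpret lemniscatic_map P s "a 1" "a 2" "m 1" "m 2" c \<Phi>
    by unfold_locales (use assms(4,13) ane mpos msum c0 W1(4-6) in \<open>simp_all add: n_def L_def K_def\<close>)
  have P0: "P \<noteq> 0" using degP by auto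
  obtain \<gamma> where \<gamma>: "surrounds \<gamma> (E 1) K" "surrounds (\<Phi> \<circ> \<gamma>) (connected_component_set L (a 1)) L"
    using W1(8) unfolding set2 by blast
  have sp: "simple_path \<gamma>" "pathfinish \<gamma> = pathstart \<gamma>" "E 1 \<subseteq> inside (path_image \<gamma>)" "K - E 1 \<subseteq> outside (path_image \<gamma>)"
    and sp': "simple_path (\<Phi> \<circ> \<gamma>)" "pathfinish (\<Phi> \<circ> \<gamma>) = pathstart (\<Phi> \<circ> \<gamma>)"
      "connected_component_set L (a 1) \<subseteq> inside (path_image (\<Phi> \<circ> \<gamma>))"
      "L - connected_component_set L (a 1) \<subseteq> outside (path_image (\<Phi> \<circ> \<gamma>))"
    using \<gamma> by (auto simp: surrounds_def)
  have \<gamma>K: "path_image \<gamma> \<subseteq> - K"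
    using sp inside_no_overlap[of "path_image \<gamma>"] outside_no_overlap[of "path_image \<gamma>"] by blast
  note p = simple_path_imp_path[OF sp(1)] and p' = simple_path_imp_path[OF sp'(1)]
  have aL: "a 1 \<in> L" "a 2 \<in> L" using c0 by (auto simp: L_def)
  have "a 1 \<in> connected_component_set L (a 1)" using aL by simp
  then have w1: "winding_number (\<Phi> \<circ> \<gamma>) (a 1) \<in> {1, -1}"
    using sp' by (metis insert_iff simple_closed_path_winding_number_inside subsetD)
  \<comment> \<open>The second center lies in a different component of \<open>L\<close>, which the
    image curve leaves outside.\<close>
  have w2: "winding_number (\<Phi> \<circ> \<gamma>) (a 2) = 0"
  proof -
    have "connected_component_set L (a 1) \<noteq> connected_component_set L (a 2)"
      using W1(7) unfolding set2 bij_betw_def inj_on_def by force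
    then have "a 2 \<notin> connected_component_set L (a 1)"
      using connected_component_eq by metis
    then have "a 2 \<in> outside (path_image (\<Phi> \<circ> \<gamma>))" using sp'(4) aL by blast
    then show ?thesis by (rule winding_number_zero_in_outside[OF p' sp'(2)])
  qed
  obtain \<epsilon> where \<epsilon>: "\<epsilon> \<in> {1, -1}" "(\<Sum>x\<in>#proots P. winding_number \<gamma> x) = \<epsilon> * of_nat n1"
    using winding_number_proots_surrounds[OF P0 \<gamma>(1)[unfolded K_def]] by (auto simp: n1_def)
  have "of_real (n * m 1) * winding_number (\<Phi> \<circ> \<gamma>) (a 1) = \<epsilon> * of_nat n1"
    using winding_number_m[OF p sp(2) \<gamma>K[unfolded K_def]] w2 \<epsilon>(2) by (simp add: n_def)
  \<comment> \<open>The orientations of \<open>\<gamma>\<close> and of its image are both unknown,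
    so the exponent is found up to sign; positivity decides.\<close>
  then have "complex_of_real (n * m 1) = complex_of_real n1 \<or> complex_of_real (n * m 1) = complex_of_real (- real n1)"
    using w1 \<epsilon>(1) by (auto simp: minus_equation_iff)
  then have "n * m 1 = n1 \<or> n * m 1 = - real n1" by (simp only: of_real_eq_iff)
  moreover have "n * m 1 > 0" using mpos assms(4) by simp
  ultimately have nm1: "n * m 1 = n1" by linarith
  have disj: "E 1 \<inter> E 2 = {}"
    using components_nonoverlap[of "E 1" K "E 2"] assms(6,7) by (simp add: K_def)
  have nsum: "n = n1 + n2"
  proof -
    have "{#z \<in># proots P. z \<in> E 2#} = {#z \<in># proots P. z \<notin> E 1#}"
    proof (rule filter_mset_cong[OF refl])
      fix z assume "z \<in># proots P"
      then have "poly P z = 0" using P0 by auto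
      then have "z \<in> K" unfolding K_def by (force simp: interval_preimage_def image_iff intro: bexI[of _ 0])
      then show "z \<in> E 2 \<longleftrightarrow> z \<notin> E 1" using KE disj by blast
    qed
    then have "n1 + n2 = size (proots P)"
      unfolding n1_def n2_def num_zeros_in_def by (metis multiset_partition size_union)
    then show ?thesis by (simp add: n_def size_proots_complex)
  qed
  have nm2: "n * m 2 = n2"
  proof -
    have "n * m 2 = n - n * m 1" using msum by (simp add: algebra_simps flip: distrib_left)
    then show ?thesis using nm1 nsum by simp
  qed
  interpret lemniscatic_pair P s "a 1" "a 2" "m 1" "m 2" c \<Phi> n1 n2
    by unfold_locales (use nm1 nm2 in \<open>simp_all add: n_def\<close>)
  have comp: "E 1 \<in> components K" "E 2 \<in> components K" using assms(6) by (auto simp: K_def)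
  obtain e1 where e1: "complex_of_real e1 \<in> E 1"
    using connected_cnj_symmetric_meets_reals[OF _ assms(8)] comp in_components_connected in_components_nonempty by metis
  obtain e2 where e2: "complex_of_real e2 \<in> E 2"
    using connected_cnj_symmetric_meets_reals[OF _ assms(9)] comp in_components_connected in_components_nonempty by metis
  have lt: "e1 < e2" by (rule assms(10)[OF e1 e2])
  \<comment> \<open>Otherwise a real segment inside \<open>K\<close> would join the two
    components.\<close>
  have gap: "\<exists>x. e1 < x \<and> x < e2 \<and> complex_of_real x \<notin> K"
  proof (rule ccontr)
    assume no: "\<not> ?thesis"
    have "complex_of_real ` {e1..e2} \<subseteq> K"
    proof (rule image_subsetI)
      fix x assume "x \<in> {e1..e2}"
      then show "complex_of_real x \<in> K" using no e1 e2 KE by (cases "x = e1 \<or> x = e2") auto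
    qed
    moreover have "connected (complex_of_real ` {e1..e2})" by (intro connected_continuous_image continuous_intros) simp
    moreover have "E 1 \<inter> complex_of_real ` {e1..e2} \<noteq> {}" using e1 lt by auto
    ultimately have "complex_of_real ` {e1..e2} \<subseteq> E 1" using components_maximal[OF comp(1)] by blast
    then have "complex_of_real e2 \<in> E 1" using lt by auto
    then show False using e2 disj by blast
  qed
  obtain \<sigma> :: complex where \<sigma>: "\<sigma> = 1 \<or> \<sigma> = -1" "\<And>j. cnj (coeff P j) = \<sigma> * coeff P j"
  proof (cases "\<forall>j. coeff P j \<in> \<real>")
    case True
    then show ?thesis by (intro that[of 1]) (auto simp: Reals_cnj_iff)
  next
    case False
    then have "\<forall>j. Re (coeff P j) = 0" using assms(5) by blast
    then show ?thesis by (intro that[of "-1"]) (auto simp: complex_eq_iff)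
  qed
  interpret symmetric_lemniscatic_pair P s "a 1" "a 2" "m 1" "m 2" c \<Phi> n1 n2 \<sigma> z1 e1 e2
    by unfold_locales (use \<sigma> assms(11,12) e1 e2 KE gap in \<open>auto simp: K_def\<close>)
  \<comment> \<open>The curve around \<open>E 1\<close> leaves \<open>e2\<close> outside, while its
    image winds around \<open>a 1\<close>.\<close>
  have "Re d > 0"
  proof (rule d_pos[OF p sp(2) \<gamma>K[unfolded K_def]])
    have "complex_of_real e2 \<in> outside (path_image \<gamma>)" using sp(4) e2 KE disj by blast
    then show "winding_number \<gamma> (complex_of_real e2) = 0" by (rule winding_number_zero_in_outside[OF p sp(2)])
    show "winding_number (\<Phi> \<circ> \<gamma>) (a 1) \<noteq> 0" using w1 by auto
  qed
  from center_formula[OF this] show ?thesis unfolding n_def .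
qed

end
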